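(* Let $\hat u_\phi\in\arg\min_{u\in\mathcal{P}}\hat{\mathcal{L}}(u)$ be a minimizer of the empirical SPINNs loss over $\mathcal{P}=\mathcal{N}(\mathcal{D},\mathcal{W},\{\|\cdot\|_{C^2(\overline{\Omega_T})},\mathcal{B}\},\{ReLU^3\})$, and let $u^*$ be the exact solution of the wave equation problem. Assume $\mathcal{L}(\hat u_\phi)-\mathcal{L}(u^* )<1$. Then there is a constant $C(T)$ depending only on $T$ such that, with $v=\hat u_\phi-u^*$ and $$\gamma=C(T)\big(1+3\sqrt d\,\mathcal{B}\,|\partial\Omega_T|\big),$$ one has, for every $t\in[0,T]$, $$\int_\Omega\Big(v_t^2+\sum_{i=1}^d v_{x_i}^2\Big)(x,t)\,dx+\int_\Omega v(x,t)^2\,dx\ \le\ \gamma\,\big(\mathcal{L}(\hat u_\phi)-\mathcal{L}(u^* )\big)^{1/2}.$$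
   Context: Setting: $\Omega=(0,1)^d$, $T>0$, $\Omega_T=\Omega\times[0,T]$, $\partial\Omega_T=\partial\Omega\times[0,T]$ with measure $|\partial\Omega_T|$. The wave equation problem is $$u_{tt}-\Delta u=f \text{ in }\Omega_T,\quad u(x,0)=\varphi(x),\ u_t(x,0)=\psi(x)\ (x\in\Omega),\quad u(x,t)=g(x,t)\ (x\in\partial\Omega,\ t\in[0,T]),$$ with $\Delta u=\sum_{i=1}^d u_{x_ix_i}$. Standing assumptions: it has a unique strong solution $u^*\in C^2(\Omega_T)\cap C(\overline{\Omega_T})$, with $\|u^*\|_{C^2(\overline{\Omega_T})}<\infty$; $f,\varphi,\psi,g$ and their derivatives are bounded in $L^\infty$ by a constant $\kappa$; $\mathcal{B}:=\max\{2\|u^*\|_{C^2(\overline{\Omega_T})},\kappa^4\}$. Here $\|u\|_{C^s(\overline{\Omega_T})}=\max_{|\alpha|\le s,\,(x,t)\in\overline{\Omega_T}}|D^\alpha u(x,t)|$. Loss functional: $$\mathcal{L}(u)=\|u_{tt}-\Delta u-f\|^2_{L^2(\Omega_T)}+\|u(\cdot,0)-\varphi\|^2_{H^1(\Omega)}+\|u_t(\cdot,0)-\psi\|^2_{L^2(\Omega)}+\|u-g\|^2_{H^1(\partial\Omega_T)},$$ where $\|w\|^2_{H^1(\partial\Omega_T)}=\int_0^T\int_{\partial\Omega}\big(w^2+w_t^2+\sum_{i=1}^d w_{x_i}^2\big)\,ds\,dt$. It is a standing fact of the setting that $\mathcal{L}(u^* )=0$ (in particular the first derivatives of $g$ entering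 the boundary term agree with those of $u^*$ on $\partial\Omega_T$). Empirical loss: for i.i.d. samples $X_1,\dots,X_N$ uniform on $\Omega$, $Y_1,\dots,Y_M$ uniform on $\partial\Omega$, $T_1,\dots,T_K$ uniform on $[0,T]$ (with $|T|$ the length of $[0,T]$), $$\hat{\mathcal{L}}(u)=\tfrac{|\Omega||T|}{NK}\sum_{n,k}(u_{tt}-\Delta u-f)^2(X_n,T_k)+\tfrac{|\Omega|}{N}\sum_n\Big[(u(X_n,0)-\varphi(X_n))^2+\sum_{i=1}^d(u_{x_i}(X_n,0)-\varphi_{x_i}(X_n))^2+(u_t(X_n,0)-\psi(X_n))^2\Big]$$ $$+\tfrac{|\partial\Omega||T|}{MK}\sum_{m,k}\Big[(u-g)^2+(u_t-g_t)^2+\sum_{i=1}^d(u_{x_i}-g_{x_i})^2\Big](Y_m,T_k).$$ Networks: a function $f:\mathbb{R}^{d+1}\to\mathbb{R}$ is implemented by a neural network of depth $\mathcal{D}$ if $f_0(x)=x$, $f_l(x)=\rho_l(A_lf_{l-1}(x)+b_l)$ for $l=1,\dots,\mathcal{D}-1$, and $f=A_{\mathcal{D}}f_{\mathcal{D}-1}+b_{\mathcal{D}}$, with $A_l\in\mathbb{R}^{n_l\times n_{l-1}}$, $b_l\in\mathbb{R}^{n_l}$, and $\rho_l$ acting componentwise by activation functions $\rho_i^{(l)}$; the width is $\mathcal{W}=\max_l n_l$. $\mathcal{N}(\mathcal{D},\mathcal{W},\{\|\cdot\|_X,\mathcal{B}\},\Phi)$ is the set of functions $f$ implemented by a network of depth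 $\mathcal{D}$ and width $\mathcal{W}$ with $\|f\|_X\le\mathcal{B}$ and all $\rho_i^{(l)}\in\Phi$. $ReLU^3(x)=x^3$ for $x\ge0$ and $0$ otherwise. *)

theory Defs
  imports "HOL-Analysis.Analysis"
begin

text \<open>
  The spatial dimension \<open>d\<close> is quantified inside the statement (the constant \<open>C(T)\<close> must not
  depend on it), so \<open>\<real>\<^sup>n\<close> is modelled by the functions \<open>nat \<Rightarrow> real\<close> that are extensional on
  \<open>{..<n}\<close>, with the product topology and the product Lebesgue measure.  A space-time point of
  \<open>\<real>\<^sup>d \<times> \<real>\<close> is a function on \<open>{..<Suc d}\<close>: the coordinates \<open>i < d\<close> are spatial, coordinate \<open>d\<close> is
  time, and \<open>(x,t)\<close> is written \<open>x(d := t)\<close>.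
\<close>

definition vol :: "nat \<Rightarrow> (nat \<Rightarrow> real) measure" where
  "vol n = (\<Pi>\<^sub>M i\<in>{..<n}. lborel)"

definition Omega :: "nat \<Rightarrow> (nat \<Rightarrow> real) set" where
  "Omega d = (\<Pi>\<^sub>E i\<in>{..<d}. {0<..<1})"

definition bdry_Omega :: "nat \<Rightarrow> (nat \<Rightarrow> real) set" where
  "bdry_Omega d = (\<Pi>\<^sub>E i\<in>{..<d}. {0..1}) - Omega d"

definition cyl :: "nat \<Rightarrow> real \<Rightarrow> (nat \<Rightarrow> real) set \<Rightarrow> (nat \<Rightarrow> real) set" where
  "cyl d T S = (\<lambda>(x, t). x(d := t)) ` (S \<times> {0..T})"

abbreviation Omega_T :: "nat \<Rightarrow> real \<Rightarrow> (nat \<Rightarrow> real) set" where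
  "Omega_T d T \<equiv> cyl d T (Omega d)"

abbreviation bdry_Omega_T :: "nat \<Rightarrow> real \<Rightarrow> (nat \<Rightarrow> real) set" where
  "bdry_Omega_T d T \<equiv> cyl d T (bdry_Omega d)"

abbreviation closed_Omega_T :: "nat \<Rightarrow> real \<Rightarrow> (nat \<Rightarrow> real) set" where
  "closed_Omega_T d T \<equiv> cyl d T (\<Pi>\<^sub>E i\<in>{..<d}. {0..1})"

text \<open>
  Partial derivatives are taken within the range of the coordinate, so that they are the ordinary
  ones at interior points and the one-sided ones on the boundary of the space-time cylinder.
\<close>

definition side :: "nat \<Rightarrow> real \<Rightarrow> nat \<Rightarrow> real set" where
  "side d T i = (if i < d then {0..1} else {0..T})"

definition pd :: "(nat \<Rightarrow> real set) \<Rightarrow> nat \<Rightarrow> ((nat \<Rightarrow> real) \<Rightarrow> real) \<Rightarrow> (nat \<Rightarrow> real) \<Rightarrow> real" where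
  "pd I i u z = vector_derivative (\<lambda>r. u (z(i := r))) (at (z i) within I i)"

text \<open>
  \<open>D I [i\<^sub>1, \<dots>, i\<^sub>k] u\<close> is the iterated partial derivative of \<open>u\<close> along \<open>i\<^sub>1, \<dots>, i\<^sub>k\<close>.  Words of length
  \<open>k\<close> replace multi-indices of order \<open>k\<close>; for \<open>C\<^sup>k\<close> functions both give the same derivatives.
\<close>

definition D :: "(nat \<Rightarrow> real set) \<Rightarrow> nat list \<Rightarrow> ((nat \<Rightarrow> real) \<Rightarrow> real) \<Rightarrow> (nat \<Rightarrow> real) \<Rightarrow> real" where
  "D I w u = foldr (pd I) w u"

definition dwords :: "nat \<Rightarrow> nat \<Rightarrow> nat list set" where
  "dwords n s = {w. set w \<subseteq> {..<n} \<and> length w \<le> s}"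

text \<open>\<open>C_class I n s S u\<close>: the function \<open>u\<close> of \<open>n\<close> variables is of class \<open>C\<^sup>s\<close> on \<open>S\<close>.\<close>

definition C_class ::
  "(nat \<Rightarrow> real set) \<Rightarrow> nat \<Rightarrow> nat \<Rightarrow> (nat \<Rightarrow> real) set \<Rightarrow> ((nat \<Rightarrow> real) \<Rightarrow> real) \<Rightarrow> bool" where
  "C_class I n s S u \<longleftrightarrow>
     (\<forall>w\<in>dwords n s. continuous_on S (D I w u)) \<and>
     (\<forall>w i. i # w \<in> dwords n s \<longrightarrow>
        (\<forall>z\<in>S. (\<lambda>r. D I w u (z(i := r))) differentiable (at (z i) within I i)))"

text \<open>As usual for the norm of a function space, the norm is infinite outside the space.\<close>

definition C_norm ::
  "(nat \<Rightarrow> real set) \<Rightarrow> nat \<Rightarrow> nat \<Rightarrow> (nat \<Rightarrow> real) set \<Rightarrow> ((nat \<Rightarrow> real) \<Rightarrow> real) \<Rightarrow> ennreal" where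
  "C_norm I n s S u =
     (if C_class I n s S u then SUP w\<in>dwords n s. SUP z\<in>S. ennreal \<bar>D I w u z\<bar> else \<infinity>)"

definition C2_norm :: "nat \<Rightarrow> real \<Rightarrow> ((nat \<Rightarrow> real) \<Rightarrow> real) \<Rightarrow> ennreal" where
  "C2_norm d T u = C_norm (side d T) (Suc d) 2 (closed_Omega_T d T) u"

text \<open>
  Surface integral over the boundary of the unit cube: the sum over the \<open>2 d\<close> open faces
  \<open>x\<^sub>i = s\<close>, \<open>s \<in> {0,1}\<close>, each with the Lebesgue measure of the other \<open>d - 1\<close> variables (unit point
  mass if \<open>d = 1\<close>); the lower-dimensional edges are null sets.
\<close>

definition surface_integral :: "nat \<Rightarrow> ((nat \<Rightarrow> real) \<Rightarrow> real) \<Rightarrow> real" where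
  "surface_integral d h =
     (\<Sum>i<d. \<Sum>s\<in>{0, 1}.
        LINT y:(\<Pi>\<^sub>E j\<in>{..<d} - {i}. {0<..<1})|(\<Pi>\<^sub>M j\<in>{..<d} - {i}. lborel). h (y(i := s)))"

definition lateral_integral :: "nat \<Rightarrow> real \<Rightarrow> ((nat \<Rightarrow> real) \<Rightarrow> real) \<Rightarrow> real" where
  "lateral_integral d T h = (LINT t:{0..T}|lborel. surface_integral d (\<lambda>x. h (x(d := t))))"

abbreviation area_bdry_Omega :: "nat \<Rightarrow> real" where
  "area_bdry_Omega d \<equiv> surface_integral d (\<lambda>_. 1)"

abbreviation area_bdry_Omega_T :: "nat \<Rightarrow> real \<Rightarrow> real" where
  "area_bdry_Omega_T d T \<equiv> lateral_integral d T (\<lambda>_. 1)"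

definition wave_op :: "nat \<Rightarrow> real \<Rightarrow> ((nat \<Rightarrow> real) \<Rightarrow> real) \<Rightarrow> (nat \<Rightarrow> real) \<Rightarrow> real" where
  "wave_op d T u z = D (side d T) [d, d] u z - (\<Sum>i<d. D (side d T) [i, i] u z)"

definition strong_solution ::
  "nat \<Rightarrow> real \<Rightarrow> ((nat \<Rightarrow> real) \<Rightarrow> real) \<Rightarrow> ((nat \<Rightarrow> real) \<Rightarrow> real) \<Rightarrow> ((nat \<Rightarrow> real) \<Rightarrow> real)
    \<Rightarrow> ((nat \<Rightarrow> real) \<Rightarrow> real) \<Rightarrow> ((nat \<Rightarrow> real) \<Rightarrow> real) \<Rightarrow> bool" where
  "strong_solution d T f \<phi> \<psi> g u \<longleftrightarrow>
     C_class (side d T) (Suc d) 2 (Omega_T d T) u \<and>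
     continuous_on (closed_Omega_T d T) u \<and>
     (\<forall>z\<in>Omega_T d T. wave_op d T u z = f z) \<and>
     (\<forall>x\<in>Omega d. u (x(d := 0)) = \<phi> x) \<and>
     (\<forall>x\<in>Omega d. pd (side d T) d u (x(d := 0)) = \<psi> x) \<and>
     (\<forall>z\<in>bdry_Omega_T d T. u z = g z)"

definition H1_sq :: "nat \<Rightarrow> real \<Rightarrow> ((nat \<Rightarrow> real) \<Rightarrow> real) \<Rightarrow> real" where
  "H1_sq d T w =
     (LINT x:Omega d|vol d. (w x)\<^sup>2 + (\<Sum>i<d. (pd (side d T) i w x)\<^sup>2))"

definition H1_bdry_sq :: "nat \<Rightarrow> real \<Rightarrow> ((nat \<Rightarrow> real) \<Rightarrow> real) \<Rightarrow> real" where
  "H1_bdry_sq d T w =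
     lateral_integral d T (\<lambda>z. (w z)\<^sup>2 + (pd (side d T) d w z)\<^sup>2 + (\<Sum>i<d. (pd (side d T) i w z)\<^sup>2))"

text \<open>The boundary datum \<open>g\<close> is a function of space-time, since its full gradient enters the loss.\<close>

definition loss ::
  "nat \<Rightarrow> real \<Rightarrow> ((nat \<Rightarrow> real) \<Rightarrow> real) \<Rightarrow> ((nat \<Rightarrow> real) \<Rightarrow> real) \<Rightarrow> ((nat \<Rightarrow> real) \<Rightarrow> real)
    \<Rightarrow> ((nat \<Rightarrow> real) \<Rightarrow> real) \<Rightarrow> ((nat \<Rightarrow> real) \<Rightarrow> real) \<Rightarrow> real" where
  "loss d T f \<phi> \<psi> g u =
     (LINT z:Omega_T d T|vol (Suc d). (wave_op d T u z - f z)\<^sup>2)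
     + H1_sq d T (\<lambda>x. u (x(d := 0)) - \<phi> x)
     + (LINT x:Omega d|vol d. (pd (side d T) d u (x(d := 0)) - \<psi> x)\<^sup>2)
     + H1_bdry_sq d T (\<lambda>z. u z - g z)"

text \<open>
  The empirical loss at a realisation \<open>X, Y, \<tau>\<close> of the samples; sample indices run over
  \<open>{..<N}\<close>, \<open>{..<M}\<close>, \<open>{..<K}\<close>.
\<close>

definition empirical_loss ::
  "nat \<Rightarrow> real \<Rightarrow> ((nat \<Rightarrow> real) \<Rightarrow> real) \<Rightarrow> ((nat \<Rightarrow> real) \<Rightarrow> real) \<Rightarrow> ((nat \<Rightarrow> real) \<Rightarrow> real)
    \<Rightarrow> ((nat \<Rightarrow> real) \<Rightarrow> real) \<Rightarrow> nat \<Rightarrow> nat \<Rightarrow> nat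
    \<Rightarrow> (nat \<Rightarrow> nat \<Rightarrow> real) \<Rightarrow> (nat \<Rightarrow> nat \<Rightarrow> real) \<Rightarrow> (nat \<Rightarrow> real)
    \<Rightarrow> ((nat \<Rightarrow> real) \<Rightarrow> real) \<Rightarrow> real" where
  "empirical_loss d T f \<phi> \<psi> g N M K X Y \<tau> u =
     measure (vol d) (Omega d) * T / (real N * real K) *
       (\<Sum>n<N. \<Sum>k<K. (let z = (X n)(d := \<tau> k) in (wave_op d T u z - f z)\<^sup>2))
     + measure (vol d) (Omega d) / real N *
       (\<Sum>n<N. (let z = (X n)(d := 0) in
          (u z - \<phi> (X n))\<^sup>2
          + (\<Sum>i<d. (pd (side d T) i u z - pd (side d T) i \<phi> (X n))\<^sup>2)
          + (pd (side d T) d u z - \<psi> (X n))\<^sup>2))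
     + area_bdry_Omega d * T / (real M * real K) *
       (\<Sum>m<M. \<Sum>k<K. (let z = (Y m)(d := \<tau> k) in
          (u z - g z)\<^sup>2
          + (pd (side d T) d u z - pd (side d T) d g z)\<^sup>2
          + (\<Sum>i<d. (pd (side d T) i u z - pd (side d T) i g z)\<^sup>2)))"

definition ReLU3 :: "real \<Rightarrow> real" where
  "ReLU3 x = (if x \<ge> 0 then x ^ 3 else 0)"

text \<open>
  \<open>nn l\<close> is the number of units of layer \<open>l\<close>, \<open>A l i j\<close> and \<open>b l i\<close> are the entries of the weight
  matrix and bias vector of layer \<open>l\<close> (only \<open>i < nn l\<close>, \<open>j < nn (l - 1)\<close> matter), and \<open>\<rho> l i\<close> are
  the activation functions.
\<close>

primrec nn_layer ::
  "(nat \<Rightarrow> nat) \<Rightarrow> (nat \<Rightarrow> nat \<Rightarrow> nat \<Rightarrow> real) \<Rightarrow> (nat \<Rightarrow> nat \<Rightarrow> real) \<Rightarrow> (nat \<Rightarrow> nat \<Rightarrow> real \<Rightarrow> real)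
    \<Rightarrow> (nat \<Rightarrow> real) \<Rightarrow> nat \<Rightarrow> nat \<Rightarrow> real" where
  "nn_layer nn A b \<rho> x 0 = x"
| "nn_layer nn A b \<rho> x (Suc l) =
     (\<lambda>i. \<rho> (Suc l) i ((\<Sum>j<nn l. A (Suc l) i j * nn_layer nn A b \<rho> x l j) + b (Suc l) i))"

definition implemented_by_nn ::
  "nat \<Rightarrow> nat \<Rightarrow> nat \<Rightarrow> (real \<Rightarrow> real) set \<Rightarrow> ((nat \<Rightarrow> real) \<Rightarrow> real) \<Rightarrow> bool" where
  "implemented_by_nn n0 depth width \<Phi> h \<longleftrightarrow>
     (\<exists>nn A b \<rho>.
        depth \<ge> 1 \<and> nn 0 = n0 \<and> nn depth = 1 \<and>
        (\<forall>l\<in>{1..depth}. nn l \<ge> 1) \<and> Max (nn ` {1..depth}) = width \<and>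
        (\<forall>l\<in>{1..<depth}. \<forall>i<nn l. \<rho> l i \<in> \<Phi>) \<and>
        h = (\<lambda>x. (\<Sum>j<nn (depth - 1). A depth 0 j * nn_layer nn A b \<rho> x (depth - 1) j)
                 + b depth 0))"

definition NN_class ::
  "nat \<Rightarrow> nat \<Rightarrow> nat \<Rightarrow> (((nat \<Rightarrow> real) \<Rightarrow> real) \<Rightarrow> ennreal) \<Rightarrow> real \<Rightarrow> (real \<Rightarrow> real) set
    \<Rightarrow> ((nat \<Rightarrow> real) \<Rightarrow> real) set" where
  "NN_class n0 depth width norm_X B \<Phi> =
     {h. implemented_by_nn n0 depth width \<Phi> h \<and> norm_X h \<le> ennreal B}"

definition B_const :: "nat \<Rightarrow> real \<Rightarrow> real \<Rightarrow> ((nat \<Rightarrow> real) \<Rightarrow> real) \<Rightarrow> real" where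
  "B_const d T \<kappa> u = max (2 * enn2real (C2_norm d T u)) (\<kappa> ^ 4)"

text \<open>
  The standing assumptions on the data and on the exact solution \<open>u\<close>.  The bounds by \<open>\<kappa>\<close> concern
  the functions and their first order derivatives, which exist and are continuous; for continuous
  functions on these sets the essential supremum is the supremum.
\<close>

definition wave_setting ::
  "nat \<Rightarrow> real \<Rightarrow> ((nat \<Rightarrow> real) \<Rightarrow> real) \<Rightarrow> ((nat \<Rightarrow> real) \<Rightarrow> real) \<Rightarrow> ((nat \<Rightarrow> real) \<Rightarrow> real)
    \<Rightarrow> ((nat \<Rightarrow> real) \<Rightarrow> real) \<Rightarrow> real \<Rightarrow> ((nat \<Rightarrow> real) \<Rightarrow> real) \<Rightarrow> bool" where
  "wave_setting d T f \<phi> \<psi> g \<kappa> u \<longleftrightarrow>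
     strong_solution d T f \<phi> \<psi> g u \<and>
     (\<forall>w. strong_solution d T f \<phi> \<psi> g w \<longrightarrow> (\<forall>z\<in>closed_Omega_T d T. w z = u z)) \<and>
     C2_norm d T u < \<infinity> \<and>
     \<kappa> \<ge> 0 \<and>
     C_norm (side d T) (Suc d) 1 (Omega_T d T) f \<le> ennreal \<kappa> \<and>
     C_norm (side d T) d 1 (Omega d) \<phi> \<le> ennreal \<kappa> \<and>
     C_norm (side d T) d 1 (Omega d) \<psi> \<le> ennreal \<kappa> \<and>
     C_norm (side d T) (Suc d) 1 (bdry_Omega_T d T) g \<le> ennreal \<kappa> \<and>
     loss d T f \<phi> \<psi> g u = 0"

end

(*
  Let v be the difference of the two functions and e = v^2 + v_t^2 + |grad_x v|^2.  Since
  d/dt e = 2 v v_t + 2 v_t (v_tt - Lap v) + 2 div_x (v_t grad_x v), the weighted density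
  exp(-2 t) e grows at most at the rate exp(-2 t) ((v_tt - Lap v)^2 + 2 div_x (v_t grad_x v)).
  Integrating over Omega x [0,t] turns the divergence into a lateral boundary term, bounded by the
  integral of v_t^2 + |grad_x v|^2 over the boundary, so the energy at time t is at most
  2 exp(2 T) L(uhat).  As 0 <= L(uhat) < 1, this is at most 2 exp(2 T) sqrt(L(uhat)), and C(T) =
  2 exp(2 T) works because gamma >= C(T).
*)

theory Submission
  imports Defs
begin

text \<open>The weight exp(-2 t) is an integrating factor and takes the place of Gronwall's
  inequality. Its rate 2 is what Young's inequality asks for: with r = v_tt - Lap v, the terms 2 v
  v_t + 2 v_t r are at most 2 e + r^2. The flux v_t * d_i v is quadratic in first derivatives, so
  the boundary loss dominates it linearly. The factor 2 in C(T) comes from the lateral term alone: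
  there the derivatives of the two functions are compared through \<open>g\<close>, and (a - b)^2 <=
  2 a^2 + 2 b^2 doubles the boundary loss, while the share of the exact solution is zero. The
  obstacle is that all data are controlled only on the closed cylinder or its lateral boundary, with
  one-sided derivatives at the ends, whereas integrands are functions on all of
  \<open>nat \<Rightarrow> real\<close>. Hence measurability is obtained for globally defined
  substitutes of the integrands, the fundamental theorem is used with derivatives inside and
  continuity up to the ends, and mixed derivatives are exchanged at interior points only.\<close>

section \<open>Measurability and Fubini on boxes in finite products\<close>

text \<open>Links two sigma-algebras on \<open>nat \<Rightarrow> real\<close>: the one of the
  product measure, living on functions extensional on \<open>J\<close>, and the Borel one of the
  product topology. Coordinates outside \<open>J\<close> are constantly \<open>undefined\<close>,
  hence measurable. Every Borel function thereby becomes measurable for every product measure used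
  here.\<close>

lemma ident_measurable_PiM_borel:
  "(\<lambda>x. x) \<in> borel_measurable (PiM J (\<lambda>_. lborel :: real measure) :: (nat \<Rightarrow> real) measure)"
proof (rule measurable_coordinatewise_then_product)
  fix i
  show "(\<lambda>x. x i) \<in> borel_measurable (PiM J (\<lambda>_. lborel :: real measure) :: (nat \<Rightarrow> real) measure)"
  proof (cases "i \<in> J")
    case True
    then show ?thesis by (metis measurable_component_singleton measurable_lborel1)
  next
    case False
    then have "x i = undefined" if "x \<in> space (PiM J (\<lambda>_. lborel :: real measure))" for x
      using that by (auto simp: space_PiM PiE_def extensional_def)
    then show ?thesis by (subst measurable_cong[where g="\<lambda>_. undefined"]) auto
  qed
qed

lemma upd_measurable_PiM_borel:
  "(\<lambda>(x, r). x(i := r)) \<in> borel_measurable (PiM J (\<lambda>_. lborel :: real measure) \<Otimes>\<^sub>M lborel :: ((nat \<Rightarrow> real) \<times> real) measure)"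
proof (rule measurable_coordinatewise_then_product)
  fix j
  have "(\<lambda>p. fst p j) \<in> borel_measurable (PiM J (\<lambda>_. lborel :: real measure) \<Otimes>\<^sub>M lborel :: ((nat \<Rightarrow> real) \<times> real) measure)"
    using measurable_compose[OF measurable_fst measurable_product_then_coordinatewise[OF ident_measurable_PiM_borel]] .
  then show "(\<lambda>p. (case p of (x, r) \<Rightarrow> x(i := r)) j) \<in> borel_measurable (PiM J (\<lambda>_. lborel :: real measure) \<Otimes>\<^sub>M lborel :: ((nat \<Rightarrow> real) \<times> real) measure)"
    by (cases "i = j") (auto simp: case_prod_beta)
qed

text \<open>The working class of integrands. Measurability and bound are global, so the class is
  stable under overwriting a coordinate and under partial integration, and its members are
  integrable over every set of finite measure that occurs.\<close>

definition bdd_borel :: "('a::topological_space \<Rightarrow> real) \<Rightarrow> bool" where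
  "bdd_borel h \<longleftrightarrow> h \<in> borel_measurable borel \<and> (\<exists>C. \<forall>x. \<bar>h x\<bar> \<le> C)"

text \<open>Imposed on all indices at once, so that one family \<open>I\<close> serves the boxes
  over \<open>J\<close> and over \<open>insert i J\<close> alike.\<close>

definition fin_meas :: "(nat \<Rightarrow> real set) \<Rightarrow> bool" where
  "fin_meas I \<longleftrightarrow> (\<forall>i. I i \<in> sets borel \<and> emeasure lborel (I i) < \<infinity>)"

lemma PiE_sets_vol:
  assumes "finite J" "fin_meas I"
  shows "PiE J I \<in> sets (PiM J (\<lambda>_. lborel))" "emeasure (PiM J (\<lambda>_. lborel)) (PiE J I) < \<infinity>"
proof -
  interpret product_sigma_finite "\<lambda>_::nat. lborel :: real measure" ..
  show "PiE J I \<in> sets (PiM J (\<lambda>_. lborel))"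
    using assms by (intro sets_PiM_I_finite) (auto simp: fin_meas_def)
  have "emeasure (PiM J (\<lambda>_. lborel)) (PiE J I) = (\<Prod>i\<in>J. emeasure lborel (I i))"
    using assms by (intro emeasure_PiM) (auto simp: fin_meas_def)
  also have "\<dots> < \<infinity>"
    using assms by (simp add: fin_meas_def ennreal_prod_eq_top infinity_ennreal_def less_top[symmetric])
  finally show "emeasure (PiM J (\<lambda>_. lborel)) (PiE J I) < \<infinity>" .
qed

lemma set_integrable_bdd:
  fixes f :: "'a \<Rightarrow> real"
  assumes "A \<in> sets M" "emeasure M A < \<infinity>" "f \<in> borel_measurable M" "\<And>x. \<bar>f x\<bar> \<le> C"
  shows "set_integrable M A f"
  unfolding set_integrable_def
  using assms by (intro integrableI_bounded_set_indicator[where B=C]) auto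

lemma box_integrable:
  assumes "finite J" "fin_meas I" "bdd_borel h"
  shows "set_integrable (PiM J (\<lambda>_. lborel)) (PiE J I) h"
proof -
  from assms obtain C where C: "\<And>x. \<bar>h x\<bar> \<le> C" unfolding bdd_borel_def by auto
  have "h \<in> borel_measurable borel" using assms by (simp add: bdd_borel_def)
  from measurable_compose[OF ident_measurable_PiM_borel this]
  have "h \<in> borel_measurable (PiM J (\<lambda>_. lborel))" .
  from set_integrable_bdd[OF PiE_sets_vol[OF assms(1,2)] this C] show ?thesis .
qed

lemma interval_integrable:
  assumes "fin_meas I" "bdd_borel h"
  shows "set_integrable lborel (I i) h"
proof -
  from assms obtain C where C: "\<And>x. \<bar>h x\<bar> \<le> C" unfolding bdd_borel_def by auto
  have "I i \<in> sets lborel" "emeasure lborel (I i) < \<infinity>" "h \<in> borel_measurable lborel"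
    using assms by (simp_all add: bdd_borel_def fin_meas_def)
  from set_integrable_bdd[OF this C] show ?thesis .
qed

lemma bdd_borel_continuous:
  "continuous_on UNIV h \<Longrightarrow> (\<And>x. \<bar>h x\<bar> \<le> C) \<Longrightarrow> bdd_borel h"
  by (auto simp: bdd_borel_def borel_measurable_continuous_onI)

lemma bdd_borel_compose:
  "bdd_borel h \<Longrightarrow> g \<in> borel_measurable borel \<Longrightarrow> bdd_borel (\<lambda>x. h (g x))"
  by (auto simp: bdd_borel_def intro: measurable_compose)

lemma continuous_on_fun_upd:
  fixes f :: "'a::topological_space \<Rightarrow> 'b \<Rightarrow> 'c::topological_space"
  assumes "continuous_on S f" "continuous_on S g"
  shows "continuous_on S (\<lambda>x. (f x)(i := g x))"
proof (rule continuous_on_coordinatewise_then_product)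
  fix j show "continuous_on S (\<lambda>x. ((f x)(i := g x)) j)"
    using assms continuous_on_product_then_coordinatewise[OF assms(1)] by (cases "j = i") auto
qed

lemma bdd_borel_fun_upd: "bdd_borel (h :: (nat \<Rightarrow> real) \<Rightarrow> real) \<Longrightarrow> bdd_borel (\<lambda>x. h (x(i := r)))"
  by (erule bdd_borel_compose)
    (intro borel_measurable_continuous_onI continuous_on_fun_upd continuous_on_id continuous_on_const)

lemma bdd_borel_fun_upd_value: "bdd_borel (h :: (nat \<Rightarrow> real) \<Rightarrow> real) \<Longrightarrow> bdd_borel (\<lambda>r. h (x(i := r)))"
  by (erule bdd_borel_compose)
    (intro borel_measurable_continuous_onI continuous_on_fun_upd continuous_on_id continuous_on_const)

text \<open>Partial integration does not leave the class, which makes the outer integrals of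
  iterated integrals integrable. The bound is that of \<open>h\<close> times the measure of the
  box.\<close>

lemma bdd_borel_box_integral:
  assumes "finite J" "fin_meas I" and h: "bdd_borel (h :: (nat \<Rightarrow> real) \<Rightarrow> real)"
  shows "bdd_borel (\<lambda>r. LINT x:PiE J I|PiM J (\<lambda>_. lborel). h (x(i := r)))"
proof -
  interpret product_sigma_finite "\<lambda>_::nat. lborel :: real measure" ..
  interpret finite_product_sigma_finite "\<lambda>_::nat. lborel :: real measure" J
    by standard fact
  let ?M = "PiM J (\<lambda>_. lborel) :: (nat \<Rightarrow> real) measure"
  from h obtain C where C: "\<And>x. \<bar>h x\<bar> \<le> C" unfolding bdd_borel_def by auto
  have [measurable]: "h \<in> borel_measurable borel" using h by (simp add: bdd_borel_def)
  have [measurable]: "PiE J I \<in> sets ?M" using PiE_sets_vol assms by auto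
  have [measurable]: "(\<lambda>p. (snd p)(i := fst p)) \<in> borel_measurable (lborel \<Otimes>\<^sub>M ?M)"
    using measurable_compose[OF measurable_pair_swap' upd_measurable_PiM_borel[of i J]]
    by (simp add: case_prod_beta)
  have "(\<lambda>p. indicator (PiE J I) (snd p) *\<^sub>R h ((snd p)(i := fst p))) \<in> borel_measurable (lborel \<Otimes>\<^sub>M ?M)"
    by measurable
  then have "(\<lambda>r. LINT x:PiE J I|?M. h (x(i := r))) \<in> borel_measurable lborel"
    unfolding set_lebesgue_integral_def
    by (intro borel_measurable_lebesgue_integral) (simp add: case_prod_beta)
  moreover have "\<bar>LINT x:PiE J I|?M. h (x(i := r))\<bar> \<le> (LINT x:PiE J I|?M. C)" for r
  proof -
    have int: "set_integrable ?M (PiE J I) (\<lambda>x. h (x(i := r)))"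
      by (rule box_integrable[OF assms(1,2) bdd_borel_fun_upd[OF h]])
    have "\<bar>LINT x:PiE J I|?M. h (x(i := r))\<bar> \<le> (LINT x:PiE J I|?M. \<bar>h (x(i := r))\<bar>)"
      using set_integral_norm_bound[OF int] by simp
    also have "\<dots> \<le> (LINT x:PiE J I|?M. C)"
      by (rule set_integral_mono[OF set_integrable_abs[OF int] box_integrable[OF assms(1,2)] C])
        (auto simp: bdd_borel_def)
    finally show ?thesis .
  qed
  ultimately show ?thesis unfolding bdd_borel_def by auto
qed

lemma bdd_borel_line_integral:
  assumes "fin_meas I" and h: "bdd_borel (h :: (nat \<Rightarrow> real) \<Rightarrow> real)"
  shows "bdd_borel (\<lambda>x. LINT r:I j|lborel. h (x(i := r)))"
proof -
  from h obtain C where C: "\<And>x. \<bar>h x\<bar> \<le> C" unfolding bdd_borel_def by auto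
  have [measurable]: "h \<in> borel_measurable borel" using h by (simp add: bdd_borel_def)
  have [measurable]: "I j \<in> sets borel" using assms by (auto simp: fin_meas_def)
  have [measurable]: "(\<lambda>p :: (nat \<Rightarrow> real) \<times> real. (fst p)(i := snd p)) \<in> borel_measurable (borel \<Otimes>\<^sub>M borel)"
  proof (rule measurable_coordinatewise_then_product)
    fix j
    have "(\<lambda>p. fst p j) \<in> borel_measurable (borel \<Otimes>\<^sub>M borel :: ((nat \<Rightarrow> real) \<times> real) measure)"
      by (rule measurable_compose[OF measurable_fst measurable_product_coordinates])
    then show "(\<lambda>p :: (nat \<Rightarrow> real) \<times> real. ((fst p)(i := snd p)) j) \<in> borel_measurable (borel \<Otimes>\<^sub>M borel)"
      by (cases "i = j") auto
  qed
  have "(\<lambda>p. indicator (I j) (snd p) *\<^sub>R h ((fst p)(i := snd p))) \<in> borel_measurable (borel \<Otimes>\<^sub>M borel)"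
    by measurable
  then have "(\<lambda>p. indicator (I j) (snd p) *\<^sub>R h ((fst p)(i := snd p))) \<in> borel_measurable (borel \<Otimes>\<^sub>M lborel)"
    by (simp cong: measurable_cong_sets)
  then have "(\<lambda>x. LINT r:I j|lborel. h (x(i := r))) \<in> borel_measurable borel"
    unfolding set_lebesgue_integral_def
    by (intro lborel.borel_measurable_lebesgue_integral) (simp add: case_prod_beta)
  moreover have "\<bar>LINT r:I j|lborel. h (x(i := r))\<bar> \<le> (LINT r:I j|lborel. C)" for x
  proof -
    have int: "set_integrable lborel (I j) (\<lambda>r. h (x(i := r)))"
      by (rule interval_integrable[OF assms(1) bdd_borel_fun_upd_value[OF h]])
    have "\<bar>LINT r:I j|lborel. h (x(i := r))\<bar> \<le> (LINT r:I j|lborel. \<bar>h (x(i := r))\<bar>)"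
      using set_integral_norm_bound[OF int] by simp
    also have "\<dots> \<le> (LINT r:I j|lborel. C)"
      by (rule set_integral_mono[OF set_integrable_abs[OF int] interval_integrable[OF assms(1)] C])
        (auto simp: bdd_borel_def)
    finally show ?thesis .
  qed
  ultimately show ?thesis unfolding bdd_borel_def by auto
qed

text \<open>The coordinate \<open>i\<close> can be integrated innermost or outermost; equating the
  two right-hand sides exchanges the order of integration. The second order needs a detour through
  the one-factor product over \<open>{i}\<close>, which is then identified with
  \<open>lborel\<close>.\<close>

lemma box_integral_insert:
  fixes h :: "(nat \<Rightarrow> real) \<Rightarrow> real"
  assumes J: "finite J" "i \<notin> J" and I: "fin_meas I" and h: "bdd_borel h"
  shows "(LINT x:PiE (insert i J) I|PiM (insert i J) (\<lambda>_. lborel). h x)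
      = (LINT x:PiE J I|PiM J (\<lambda>_. lborel). LINT r:I i|lborel. h (x(i := r)))"
    (is "?lhs = ?r1")
    and "(LINT x:PiE (insert i J) I|PiM (insert i J) (\<lambda>_. lborel). h x)
      = (LINT r:I i|lborel. LINT x:PiE J I|PiM J (\<lambda>_. lborel). h (x(i := r)))"
    (is "_ = ?r2")
proof -
  interpret product_sigma_finite "\<lambda>_::nat. lborel :: real measure" ..
  let ?g = "\<lambda>x. indicator (PiE (insert i J) I) x *\<^sub>R h x"
  have int: "integrable (PiM (insert i J) (\<lambda>_. lborel)) ?g"
    using box_integrable[of "insert i J" I h] assms by (simp add: set_integrable_def)
  \<comment> \<open>The indicator of a box factorises. This relies on \<open>x\<close> being
    extensional on \<open>J\<close>, hence the restriction to the space of the product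
    measure.\<close>
  have upd: "?g (x(i := r)) = indicator (PiE J I) x *\<^sub>R (indicator (I i) r *\<^sub>R h (x(i := r)))"
    if "x \<in> space (PiM J (\<lambda>_. lborel :: real measure))" for x r
  proof -
    have "x(i := r) \<in> PiE (insert i J) I \<longleftrightarrow> x \<in> PiE J I \<and> r \<in> I i"
      using that J(2) by (auto simp: PiE_iff space_PiM extensional_def)
    then show ?thesis by (auto simp: indicator_def)
  qed
  have "?lhs = integral\<^sup>L (PiM (insert i J) (\<lambda>_. lborel)) ?g"
    by (simp add: set_lebesgue_integral_def)
  also have "\<dots> = (\<integral>x. (\<integral>r. ?g (x(i := r)) \<partial>lborel) \<partial>PiM J (\<lambda>_. lborel))"
    by (rule product_integral_insert[OF J int])
  also have "\<dots> = ?r1"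
    unfolding set_lebesgue_integral_def
    by (intro Bochner_Integration.integral_cong refl) (simp only: upd integral_scaleR_right)
  finally show "?lhs = ?r1" .
  have "?lhs = integral\<^sup>L (PiM ({i} \<union> J) (\<lambda>_. lborel)) ?g"
    by (simp add: set_lebesgue_integral_def)
  also have "\<dots> = (\<integral>y. (\<integral>x. ?g (merge {i} J (y, x)) \<partial>PiM J (\<lambda>_. lborel)) \<partial>PiM {i} (\<lambda>_. lborel))"
    using J int by (intro product_integral_fold) auto
  also have "\<dots> = (\<integral>y. indicator (I i) (y i) *\<^sub>R (LINT x:PiE J I|PiM J (\<lambda>_. lborel). h (x(i := y i))) \<partial>PiM {i} (\<lambda>_. lborel))"
  proof (intro Bochner_Integration.integral_cong refl)
    fix y :: "nat \<Rightarrow> real" assume y: "y \<in> space (PiM {i} (\<lambda>_. lborel))"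
    have m: "merge {i} J (y, x) = x(i := y i)" if "x \<in> space (PiM J (\<lambda>_. lborel :: real measure))" for x
    proof
      fix j show "merge {i} J (y, x) j = (x(i := y i)) j"
        using that J(2) by (cases "j = i"; cases "j \<in> J") (auto simp: merge_def space_PiM PiE_def extensional_def)
    qed
    have "(\<integral>x. ?g (merge {i} J (y, x)) \<partial>PiM J (\<lambda>_. lborel))
        = (\<integral>x. indicator (I i) (y i) *\<^sub>R (indicator (PiE J I) x *\<^sub>R h (x(i := y i))) \<partial>PiM J (\<lambda>_. lborel))"
      by (intro Bochner_Integration.integral_cong refl) (simp only: m upd, simp)
    then show "(\<integral>x. ?g (merge {i} J (y, x)) \<partial>PiM J (\<lambda>_. lborel))
      = indicator (I i) (y i) *\<^sub>R (LINT x:PiE J I|PiM J (\<lambda>_. lborel). h (x(i := y i)))"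
      by (simp only: set_lebesgue_integral_def integral_scaleR_right)
  qed
  also have "\<dots> = ?r2"
  proof -
    have "(\<lambda>r. LINT x:PiE J I|PiM J (\<lambda>_. lborel). h (x(i := r))) \<in> borel_measurable borel"
      using bdd_borel_box_integral[OF J(1) I h] by (simp add: bdd_borel_def)
    then have "(\<lambda>r. indicator (I i) r *\<^sub>R (LINT x:PiE J I|PiM J (\<lambda>_. lborel). h (x(i := r)))) \<in> borel_measurable lborel"
      using I by (simp add: fin_meas_def borel_measurable_times borel_measurable_indicator)
    from product_integral_singleton[OF this] show ?thesis
      by (simp add: set_lebesgue_integral_def)
  qed
  finally show "?lhs = ?r2" .
qed

section \<open>One-variable integration and symmetry of mixed partial derivatives\<close>

text \<open>Derivatives are required in the open interval only; the end values enter through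
  continuity. The closed form serves the time variable, the open one the spatial variables, in line
  with \<open>Omega_T\<close>; the two differ by two null points.\<close>

lemma set_integral_FTC:
  fixes F f :: "real \<Rightarrow> real"
  assumes "a \<le> b" "continuous_on {a..b} F" "continuous_on {a..b} f"
    and "\<And>x. x \<in> {a<..<b} \<Longrightarrow> (F has_real_derivative f x) (at x)"
  shows "(LINT x:{a..b}|lborel. f x) = F b - F a"
    and "(LINT x:{a<..<b}|lborel. f x) = F b - F a"
proof -
  have *: "set_integrable lborel {a..b} f"
    using borel_integrable_compact[of "{a..b}" f] assms by (simp add: set_integrable_def)
  have "(f has_integral (F b - F a)) {a..b}"
    using assms by (intro fundamental_theorem_of_calculus_interior)
      (auto simp: has_real_derivative_iff_has_vector_derivative)
  then show 1: "(LINT x:{a..b}|lborel. f x) = F b - F a"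
    using set_borel_integral_eq_integral(2)[OF *] by (auto dest: integral_unique)
  have "(LINT x:{a..b}|lborel. f x) = (LINT x:{a<..<b}|lborel. f x)"
  proof (rule set_integral_cong_set)
    show "set_borel_measurable lborel {a<..<b} f"
      using set_integrable_subset[OF *, of "{a<..<b}"] greaterThanLessThan_subseteq_atLeastAtMost_iff[of a b a b]
      by (auto simp: set_borel_measurable_def set_integrable_def)
    show "set_borel_measurable lborel {a..b} f"
      using * by (auto simp: set_borel_measurable_def set_integrable_def)
    have "AE x in lborel. x \<noteq> a" "AE x in lborel. x \<noteq> b" by (auto simp: AE_lborel_singleton)
    then show "AE x in lborel. (x \<in> {a<..<b}) = (x \<in> {a..b})" by eventually_elim auto
  qed
  with 1 show "(LINT x:{a<..<b}|lborel. f x) = F b - F a" by simp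
qed

text \<open>Schwarz's theorem by the second difference over a small square: the mean value theorem
  applied twice, in either order, equates it with h^2 times either mixed derivative at some point of
  the square. If the two differed at the corner, continuity would keep both values within half their
  gap.\<close>

lemma mixed_partials_eq:
  fixes f fx fy fxy fyx :: "real \<Rightarrow> real \<Rightarrow> real"
  assumes S: "open S" "open S'" "x0 \<in> S" "y0 \<in> S'"
    and fx: "\<And>x y. x \<in> S \<Longrightarrow> y \<in> S' \<Longrightarrow> ((\<lambda>x. f x y) has_real_derivative fx x y) (at x)"
    and fy: "\<And>x y. x \<in> S \<Longrightarrow> y \<in> S' \<Longrightarrow> ((\<lambda>y. f x y) has_real_derivative fy x y) (at y)"
    and fxy: "\<And>x y. x \<in> S \<Longrightarrow> y \<in> S' \<Longrightarrow> ((\<lambda>y. fx x y) has_real_derivative fxy x y) (at y)"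
    and fyx: "\<And>x y. x \<in> S \<Longrightarrow> y \<in> S' \<Longrightarrow> ((\<lambda>x. fy x y) has_real_derivative fyx x y) (at x)"
    and cxy: "isCont (\<lambda>(x, y). fxy x y) (x0, y0)"
    and cyx: "isCont (\<lambda>(x, y). fyx x y) (x0, y0)"
  shows "fxy x0 y0 = fyx x0 y0"
proof (rule ccontr)
  assume ne: "fxy x0 y0 \<noteq> fyx x0 y0"
  define e where "e = \<bar>fxy x0 y0 - fyx x0 y0\<bar> / 2"
  have e: "e > 0" using ne by (simp add: e_def)
  obtain d1 where d1: "d1 > 0" "\<And>p. dist p (x0, y0) < d1 \<Longrightarrow> dist (fxy (fst p) (snd p)) (fxy x0 y0) < e"
    using cxy e unfolding continuous_at_eps_delta by (auto simp: case_prod_beta)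
  obtain d2 where d2: "d2 > 0" "\<And>p. dist p (x0, y0) < d2 \<Longrightarrow> dist (fyx (fst p) (snd p)) (fyx x0 y0) < e"
    using cyx e unfolding continuous_at_eps_delta by (auto simp: case_prod_beta)
  obtain r1 where r1: "r1 > 0" "cball x0 r1 \<subseteq> S" using S open_contains_cball by metis
  obtain r2 where r2: "r2 > 0" "cball y0 r2 \<subseteq> S'" using S open_contains_cball by metis
  \<comment> \<open>Points of the square have distance below 2 h from the corner, so 2 h must stay
    below both continuity radii; a third of each leaves room for strictness.\<close>
  define h where "h = min (min (d1 / 3) (d2 / 3)) (min r1 r2)"
  have h: "h > 0" "h < d1 / 2" "h < d2 / 2" "h \<le> r1" "h \<le> r2"
    using d1 d2 r1 r2 by (auto simp: h_def min_def)
  have inS: "x \<in> S" if "x0 \<le> x" "x \<le> x0 + h" for x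
    using that h r1 by (intro subsetD[OF r1(2)]) (auto simp: dist_real_def)
  have inS': "y \<in> S'" if "y0 \<le> y" "y \<le> y0 + h" for y
    using that h r2 by (intro subsetD[OF r2(2)]) (auto simp: dist_real_def)
  have close: "dist (x, y) (x0, y0) < 2 * h" if "x0 < x" "x < x0 + h" "y0 < y" "y < y0 + h" for x y
  proof -
    have "dist (x, y) (x0, y0) \<le> \<bar>x - x0\<bar> + \<bar>y - y0\<bar>"
      unfolding dist_Pair_Pair dist_real_def using sqrt_sum_squares_le_sum_abs[of "\<bar>x - x0\<bar>" "\<bar>y - y0\<bar>"] by simp
    then show ?thesis using that by simp
  qed
  \<comment> \<open>Symmetric in the two variables: it is both the x-increment of a y-increment and
    the y-increment of an x-increment.\<close>
  define \<Delta> where "\<Delta> = f (x0 + h) (y0 + h) - f x0 (y0 + h) - (f (x0 + h) y0 - f x0 y0)"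
  have "\<exists>x>x0. x < x0 + h \<and> (f (x0 + h) (y0 + h) - f (x0 + h) y0) - (f x0 (y0 + h) - f x0 y0)
      = (x0 + h - x0) * (fx x (y0 + h) - fx x y0)"
    using h inS inS' by (intro MVT2 DERIV_diff fx) auto
  then obtain x1 where x1: "x0 < x1" "x1 < x0 + h" "\<Delta> = h * (fx x1 (y0 + h) - fx x1 y0)"
    by (auto simp: \<Delta>_def)
  have "\<exists>y>y0. y < y0 + h \<and> fx x1 (y0 + h) - fx x1 y0 = (y0 + h - y0) * fxy x1 y"
    using h inS inS' x1 by (intro MVT2 fxy) auto
  then obtain y1 where y1: "y0 < y1" "y1 < y0 + h" "\<Delta> = h * (h * fxy x1 y1)"
    using x1 by auto
  have "\<exists>y>y0. y < y0 + h \<and> (f (x0 + h) (y0 + h) - f x0 (y0 + h)) - (f (x0 + h) y0 - f x0 y0)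
      = (y0 + h - y0) * (fy (x0 + h) y - fy x0 y)"
    using h inS inS' by (intro MVT2 DERIV_diff fy) auto
  then obtain y2 where y2: "y0 < y2" "y2 < y0 + h" "\<Delta> = h * (fy (x0 + h) y2 - fy x0 y2)"
    by (auto simp: \<Delta>_def)
  have "\<exists>x>x0. x < x0 + h \<and> fy (x0 + h) y2 - fy x0 y2 = (x0 + h - x0) * fyx x y2"
    using h inS inS' y2 by (intro MVT2 fyx) auto
  then obtain x2 where x2: "x0 < x2" "x2 < x0 + h" "\<Delta> = h * (h * fyx x2 y2)"
    using y2 by auto
  have "fxy x1 y1 = fyx x2 y2" using y1(3) x2(3) h(1) by simp
  moreover have "\<bar>fxy x1 y1 - fxy x0 y0\<bar> < e"
    using d1(2)[of "(x1, y1)"] close[OF x1(1,2) y1(1,2)] h by (auto simp: dist_real_def)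
  moreover have "\<bar>fyx x2 y2 - fyx x0 y0\<bar> < e"
    using d2(2)[of "(x2, y2)"] close[OF x2(1,2) y2(1,2)] h by (auto simp: dist_real_def)
  moreover have "\<bar>fxy x0 y0 - fyx x0 y0\<bar> = 2 * e" by (simp add: e_def)
  ultimately show False by linarith
qed

section \<open>Bounded continuous functions on a set\<close>

text \<open>The local counterpart of \<open>bdd_borel\<close>: what a finite \<open>C_norm\<close>
  says about each derivative on its own set \<open>S\<close>.\<close>

definition bdd_cont :: "'a::topological_space set \<Rightarrow> ('a \<Rightarrow> real) \<Rightarrow> bool" where
  "bdd_cont S h \<longleftrightarrow> continuous_on S h \<and> (\<exists>C. \<forall>z\<in>S. \<bar>h z\<bar> \<le> C)"

lemma bdd_cont_const: "bdd_cont S (\<lambda>_. c)"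
  by (auto simp: bdd_cont_def)

lemma bdd_cont_add: "bdd_cont S f \<Longrightarrow> bdd_cont S g \<Longrightarrow> bdd_cont S (\<lambda>z. f z + g z)"
  unfolding bdd_cont_def
proof (elim conjE exE, intro conjI continuous_on_add)
  fix C C' assume "\<forall>z\<in>S. \<bar>f z\<bar> \<le> C" "\<forall>z\<in>S. \<bar>g z\<bar> \<le> C'"
  then have "\<forall>z\<in>S. \<bar>f z + g z\<bar> \<le> C + C'" by (fastforce intro: order_trans[OF abs_triangle_ineq] add_mono)
  then show "\<exists>C. \<forall>z\<in>S. \<bar>f z + g z\<bar> \<le> C" ..
qed

lemma bdd_cont_mult: "bdd_cont S f \<Longrightarrow> bdd_cont S g \<Longrightarrow> bdd_cont S (\<lambda>z. f z * g z)"
  unfolding bdd_cont_def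
proof (elim conjE exE, intro conjI continuous_on_mult)
  fix C C' assume "\<forall>z\<in>S. \<bar>f z\<bar> \<le> C" "\<forall>z\<in>S. \<bar>g z\<bar> \<le> C'"
  then have "\<forall>z\<in>S. \<bar>f z * g z\<bar> \<le> C * C'"
    by (auto simp: abs_mult intro!: mult_mono intro: order_trans[OF abs_ge_zero])
  then show "\<exists>C. \<forall>z\<in>S. \<bar>f z * g z\<bar> \<le> C" ..
qed

lemma bdd_cont_diff: "bdd_cont S f \<Longrightarrow> bdd_cont S g \<Longrightarrow> bdd_cont S (\<lambda>z. f z - g z)"
  using bdd_cont_add[OF _ bdd_cont_mult[OF bdd_cont_const[of S "-1"]], of f g] by simp

lemma bdd_cont_power2: "bdd_cont S f \<Longrightarrow> bdd_cont S (\<lambda>z. (f z)\<^sup>2)"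
  using bdd_cont_mult[of S f f] by (simp add: power2_eq_square)

lemma bdd_cont_sum:
  "(\<And>i. i \<in> A \<Longrightarrow> bdd_cont S (f i)) \<Longrightarrow> bdd_cont S (\<lambda>z. \<Sum>i\<in>A. f i z)"
  by (induction A rule: infinite_finite_induct) (simp_all add: bdd_cont_const bdd_cont_add)

lemma bdd_cont_cong: "(\<And>z. z \<in> S \<Longrightarrow> f z = g z) \<Longrightarrow> bdd_cont S f \<longleftrightarrow> bdd_cont S g"
  unfolding bdd_cont_def by (simp cong: continuous_on_cong)

lemma bdd_cont_subset: "bdd_cont S f \<Longrightarrow> S' \<subseteq> S \<Longrightarrow> bdd_cont S' f"
  unfolding bdd_cont_def using continuous_on_subset by blast

lemmas bdd_cont_intros = bdd_cont_const bdd_cont_add bdd_cont_mult bdd_cont_diff bdd_cont_power2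
  bdd_cont_sum

text \<open>The passage from local to global: a continuous map of the whole space into
  \<open>S\<close> turns local control into a globally continuous and bounded function.\<close>

lemma bdd_cont_compose_borel:
  assumes "bdd_cont S h" "continuous_on UNIV c" "\<And>x. c x \<in> S"
  shows "bdd_borel (\<lambda>x. h (c x))"
proof -
  from assms obtain C where C: "\<And>z. z \<in> S \<Longrightarrow> \<bar>h z\<bar> \<le> C" by (auto simp: bdd_cont_def)
  have "continuous_on UNIV (\<lambda>x. h (c x))"
    using assms by (intro continuous_on_compose2[of S h UNIV c]) (auto simp: bdd_cont_def)
  then show ?thesis by (rule bdd_borel_continuous) (rule C[OF assms(3)])
qed

section \<open>Geometry of the cylinder and its faces; clamping maps\<close>

lemma cyl_eq_PiE: "cyl d T (PiE {..<d} I) = PiE {..<Suc d} (\<lambda>i. if i < d then I i else {0..T})"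
proof (intro set_eqI iffI)
  fix z assume "z \<in> cyl d T (PiE {..<d} I)"
  then obtain x t where "x \<in> PiE {..<d} I" "t \<in> {0..T}" "z = x(d := t)"
    by (auto simp: cyl_def)
  then show "z \<in> PiE {..<Suc d} (\<lambda>i. if i < d then I i else {0..T})"
    by (auto simp: PiE_iff extensional_def less_Suc_eq)
next
  fix z assume z: "z \<in> PiE {..<Suc d} (\<lambda>i. if i < d then I i else {0..T})"
  then have "z i \<in> I i" if "i < d" for i
    using that PiE_mem[OF z, of i] by simp
  then have "z(d := undefined) \<in> PiE {..<d} I"
    using z by (auto simp: PiE_iff extensional_def less_Suc_eq)
  moreover have "z d \<in> {0..T}" using PiE_mem[OF z, of d] by simp
  ultimately show "z \<in> cyl d T (PiE {..<d} I)"
    unfolding cyl_def by (intro rev_image_eqI[of "(z(d := undefined), z d)"]) auto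
qed

lemma closed_cyl_eq: "closed_Omega_T d T = PiE {..<Suc d} (side d T)"
  unfolding cyl_eq_PiE side_def ..

lemma closed_cyl_coord: "z \<in> closed_Omega_T d T \<Longrightarrow> i < Suc d \<Longrightarrow> z i \<in> side d T i"
  by (auto simp: closed_cyl_eq PiE_iff)

lemma closed_cyl_upd:
  "z \<in> closed_Omega_T d T \<Longrightarrow> i < Suc d \<Longrightarrow> r \<in> side d T i \<Longrightarrow> z(i := r) \<in> closed_Omega_T d T"
  by (auto simp: closed_cyl_eq PiE_iff extensional_def)

lemma Omega_upd_closed_cyl: "x \<in> Omega d \<Longrightarrow> t \<in> {0..T} \<Longrightarrow> x(d := t) \<in> closed_Omega_T d T"
  unfolding cyl_def Omega_def by (intro image_eqI[of _ _ "(x, t)"]) (auto simp: PiE_iff less_imp_le)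

lemma Omega_T_subset_closed: "Omega_T d T \<subseteq> closed_Omega_T d T"
  using Omega_upd_closed_cyl by (auto simp: cyl_def)

lemma bdry_subset_closed: "bdry_Omega_T d T \<subseteq> closed_Omega_T d T"
  by (auto simp: cyl_def bdry_Omega_def)

text \<open>
  Composition with the clamp makes a function that is continuous on the closed cylinder continuous
  on the whole space; this reduces measurability to continuity and boundedness.
\<close>

definition cyl_clamp :: "nat \<Rightarrow> real \<Rightarrow> (nat \<Rightarrow> real) \<Rightarrow> nat \<Rightarrow> real" where
  "cyl_clamp d T z =
     (\<lambda>j. if j < d then max 0 (min 1 (z j)) else if j = d then max 0 (min T (z j)) else undefined)"

lemma continuous_cyl_clamp: "continuous_on UNIV (cyl_clamp d T)"
proof (rule continuous_on_coordinatewise_then_product)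
  fix j
  have c: "continuous_on UNIV (\<lambda>z :: nat \<Rightarrow> real. z j)"
    by (rule continuous_on_product_then_coordinatewise[OF continuous_on_id])
  have "continuous_on UNIV (\<lambda>z :: nat \<Rightarrow> real. max 0 (min b (z j)))" for b
    by (intro continuous_on_max continuous_on_min continuous_on_const c)
  then show "continuous_on UNIV (\<lambda>z. cyl_clamp d T z j)"
    unfolding cyl_clamp_def by (cases "j < d"; cases "j = d") (simp_all only: if_True if_False continuous_on_const simp_thms)
qed

lemma cyl_clamp_in: "T > 0 \<Longrightarrow> cyl_clamp d T z \<in> closed_Omega_T d T"
  unfolding closed_cyl_eq by (rule PiE_I) (simp_all add: cyl_clamp_def side_def)

lemma cyl_clamp_id:
  assumes "z \<in> closed_Omega_T d T"
  shows "cyl_clamp d T z = z"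
proof
  fix j
  show "cyl_clamp d T z j = z j"
  proof (cases "j < Suc d")
    case True
    then have "z j \<in> side d T j" by (rule closed_cyl_coord[OF assms])
    with True show ?thesis by (cases "j < d") (simp_all add: cyl_clamp_def side_def min_def max_def)
  next
    case False
    then have "z j = undefined" using PiE_arb[OF assms[unfolded closed_cyl_eq], of j] by simp
    with False show ?thesis by (auto simp: cyl_clamp_def)
  qed
qed

lemma bdd_borel_clamp:
  "T > 0 \<Longrightarrow> bdd_cont (closed_Omega_T d T) h \<Longrightarrow> bdd_borel (\<lambda>z. h (cyl_clamp d T z))"
  by (rule bdd_cont_compose_borel[OF _ continuous_cyl_clamp cyl_clamp_in])

abbreviation face_box :: "nat \<Rightarrow> nat \<Rightarrow> (nat \<Rightarrow> real) set" where
  "face_box d i \<equiv> PiE ({..<d} - {i}) (\<lambda>_. {0<..<1})"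

abbreviation face_vol :: "nat \<Rightarrow> nat \<Rightarrow> (nat \<Rightarrow> real) measure" where
  "face_vol d i \<equiv> PiM ({..<d} - {i}) (\<lambda>_. lborel)"

text \<open>Overwriting one spatial coordinate of a clamped point by 0 or 1 sends the whole space
  continuously into the lateral boundary. Integrands controlled only there, such as those containing
  \<open>g\<close>, are thereby made globally bounded and Borel.\<close>

lemma face_clamp_in:
  assumes "T > 0" "i < d" "s \<in> {0, 1}"
  shows "(cyl_clamp d T z)(i := s) \<in> bdry_Omega_T d T"
proof -
  \<comment> \<open>The spatial part of the point: the time slot \<open>d\<close> is reset so that
    \<open>w\<close> is extensional on \<open>{..<d}\<close>.\<close>
  define w where "w = (cyl_clamp d T z)(i := s, d := undefined)"
  have "w \<in> PiE {..<d} (\<lambda>_. {0..1})"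
    unfolding w_def
  proof (rule PiE_I)
    fix j assume "j \<in> {..<d}"
    then show "((cyl_clamp d T z)(i := s, d := undefined)) j \<in> {0..1}"
      using assms(2,3) by (cases "j = i") (auto simp add: cyl_clamp_def)
  next
    fix j assume "j \<notin> {..<d}"
    then show "((cyl_clamp d T z)(i := s, d := undefined)) j = undefined"
      using assms(2) by (cases "j = d") (simp_all add: cyl_clamp_def)
  qed
  moreover have "w \<notin> Omega d"
  proof
    assume "w \<in> Omega d"
    then have "w i \<in> {0<..<1}" using assms(2) PiE_mem[of w "{..<d}" "\<lambda>_. {0<..<1}" i] unfolding Omega_def by simp
    then have "0 < s" "s < 1" using assms(2) by (simp_all add: w_def)
    then show False using assms(3) by auto
  qed
  ultimately have "w \<in> bdry_Omega d" by (simp add: bdry_Omega_def)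
  moreover have "cyl_clamp d T z d \<in> {0..T}" using assms(1) by (simp add: cyl_clamp_def)
  moreover have "(cyl_clamp d T z)(i := s) = w(d := cyl_clamp d T z d)"
    using assms(2) by (simp add: w_def fun_eq_iff)
  ultimately show ?thesis unfolding cyl_def
    by (intro image_eqI[of _ _ "(w, cyl_clamp d T z d)"]) simp_all
qed

text \<open>A face point \<open>y\<close> has \<open>undefined\<close> in slot \<open>i\<close>,
  about whose clamped value nothing is known; the update by \<open>s\<close> comes after clamping
  and discards it. The other slots lie in range and are fixed by the clamp.\<close>

lemma face_clamp_id:
  assumes "i < d" "y \<in> face_box d i" "t \<in> {0..T}"
  shows "(cyl_clamp d T (y(d := t)))(i := s) = y(i := s, d := t)"
proof
  fix j
  consider "j = i" | "j = d" | "j \<in> {..<d} - {i}" | "d < j" by (cases "j < d"; cases "j = d") auto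
  then show "((cyl_clamp d T (y(d := t)))(i := s)) j = (y(i := s, d := t)) j"
  proof cases
    case 3
    then have "y j \<in> {0<..<1}" by (rule PiE_mem[OF assms(2)])
    with 3 show ?thesis by (auto simp: cyl_clamp_def)
  next
    case 4
    then have "y j = undefined" using PiE_arb[OF assms(2), of j] by auto
    with 4 assms(1) show ?thesis by (auto simp: cyl_clamp_def)
  qed (use assms in \<open>simp_all add: cyl_clamp_def min_def max_def\<close>)
qed

lemma face_upd_bdry:
  assumes "T > 0" "i < d" "s \<in> {0, 1}" "y \<in> face_box d i" "t \<in> {0..T}"
  shows "y(i := s, d := t) \<in> bdry_Omega_T d T"
  using face_clamp_in[OF assms(1-3), of "y(d := t)"] face_clamp_id[OF assms(2,4,5)] by simp

lemma bdd_borel_face: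
  assumes "T > 0" "bdd_cont (bdry_Omega_T d T) h" "i < d" "s \<in> {0, 1}"
  shows "bdd_borel (\<lambda>z. h ((cyl_clamp d T z)(i := s)))"
  by (rule bdd_cont_compose_borel[OF assms(2)
        continuous_on_fun_upd[OF continuous_cyl_clamp continuous_on_const]
        face_clamp_in[OF assms(1,3,4)]])

lemma emeasure_Icc_finite: "emeasure lborel {a..b :: real} < top"
  by (cases "a \<le> b") (simp_all add: ennreal_less_top)

lemma Omega_sets: "Omega d \<in> sets (vol d)"
proof -
  have "fin_meas (\<lambda>_. {0<..<1})" by (simp add: fin_meas_def emeasure_Icc_finite)
  from PiE_sets_vol(1)[OF _ this, of "{..<d}"] show ?thesis by (simp add: Omega_def vol_def)
qed

lemma face_sets: "face_box d i \<in> sets (face_vol d i)"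
proof -
  have "fin_meas (\<lambda>_. {0<..<1})" by (simp add: fin_meas_def emeasure_Icc_finite)
  from PiE_sets_vol(1)[OF _ this, of "{..<d} - {i}"] show ?thesis by simp
qed

lemma Omega_T_sets: "Omega_T d T \<in> sets (vol (Suc d))"
proof -
  have "fin_meas (\<lambda>i. if i < d then {0<..<1} else {0..T})" by (simp add: fin_meas_def emeasure_Icc_finite)
  from PiE_sets_vol(1)[OF _ this, of "{..<Suc d}"] show ?thesis
    by (simp add: Omega_def vol_def cyl_eq_PiE)
qed

lemma unit_interval_fin_meas: "fin_meas (\<lambda>_. {0<..<1})"
  by (simp add: fin_meas_def emeasure_Icc_finite)

lemma face_line_closed:
  assumes T: "T > 0" and "i < d" "y \<in> face_box d i" "r \<in> {0..1}" "t \<in> {0..T}"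
  shows "y(i := r, d := t) \<in> closed_Omega_T d T"
proof -
  have "cyl_clamp d T (y(d := t)) \<in> closed_Omega_T d T" by (rule cyl_clamp_in[OF T])
  from closed_cyl_upd[OF this, of i r] have "(cyl_clamp d T (y(d := t)))(i := r) \<in> closed_Omega_T d T"
    using assms by (simp add: side_def)
  then show ?thesis by (simp only: face_clamp_id[OF assms(2,3,5)])
qed

section \<open>Slice, line and space-time integrals of functions controlled on the closed
  cylinder\<close>

context
  fixes d :: nat and T :: real and h :: "(nat \<Rightarrow> real) \<Rightarrow> real"
  assumes T: "T > 0" and h: "bdd_cont (closed_Omega_T d T) h"
begin

abbreviation (input) hc where "hc \<equiv> \<lambda>z. h (cyl_clamp d T z)"

text \<open>The pattern for this group of results: the clamped integrand is globally bounded and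
  Borel, so the box lemmas apply to it, and it agrees with \<open>h\<close> wherever the integral
  looks.\<close>

lemma clamp_Omega: "x \<in> Omega d \<Longrightarrow> t \<in> {0..T} \<Longrightarrow> hc (x(d := t)) = h (x(d := t))"
  by (simp add: cyl_clamp_id Omega_upd_closed_cyl)

lemma slice_integrable:
  assumes "t \<in> {0..T}"
  shows "set_integrable (vol d) (Omega d) (\<lambda>x. h (x(d := t)))"
proof -
  have "set_integrable (vol d) (Omega d) (\<lambda>x. hc (x(d := t)))"
    using box_integrable[OF _ unit_interval_fin_meas bdd_borel_fun_upd[OF bdd_borel_clamp[OF T h]], of "{..<d}" d t]
    by (simp add: vol_def Omega_def)
  then show ?thesis
    using assms clamp_Omega by (subst set_integrable_cong[OF refl refl, of "Omega d" _ "\<lambda>x. hc (x(d := t))"]) auto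
qed

lemma slice_integral_clamp:
  assumes "t \<in> {0..T}"
  shows "(LINT x:Omega d|vol d. hc (x(d := t))) = (LINT x:Omega d|vol d. h (x(d := t)))"
  by (rule set_lebesgue_integral_cong[OF Omega_sets]) (use assms clamp_Omega in blast)

lemma slice_integral_time_integrable:
  assumes "t \<in> {0..T}"
  shows "set_integrable lborel {0..t} (\<lambda>s. LINT x:Omega d|vol d. h (x(d := s)))"
proof -
  have "bdd_borel (\<lambda>s. LINT x:Omega d|vol d. hc (x(d := s)))"
    using bdd_borel_box_integral[OF _ unit_interval_fin_meas bdd_borel_clamp[OF T h], of "{..<d}" d]
    by (simp add: vol_def Omega_def)
  from interval_integrable[OF _ this, of "\<lambda>_. {0..t}" 0]
  have "set_integrable lborel {0..t} (\<lambda>s. LINT x:Omega d|vol d. hc (x(d := s)))"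
    by (simp add: fin_meas_def emeasure_Icc_finite)
  then show ?thesis
    by (subst set_integrable_cong[OF refl refl, of "{0..t}" _ "\<lambda>s. LINT x:Omega d|vol d. hc (x(d := s))"])
      (use assms slice_integral_clamp in auto)
qed

lemma line_integral_clamp:
  assumes "t \<in> {0..T}" "x \<in> Omega d"
  shows "(LINT s:{0..t}|lborel. hc (x(d := s))) = (LINT s:{0..t}|lborel. h (x(d := s)))"
  by (rule set_lebesgue_integral_cong) (use assms clamp_Omega in auto)

lemma line_integral_integrable:
  assumes "t \<in> {0..T}"
  shows "set_integrable (vol d) (Omega d) (\<lambda>x. LINT s:{0..t}|lborel. h (x(d := s)))"
proof -
  have "fin_meas (\<lambda>_. {0..t})" by (simp add: fin_meas_def emeasure_Icc_finite)
  from bdd_borel_line_integral[OF this bdd_borel_clamp[OF T h]]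
  have "bdd_borel (\<lambda>x. LINT s:{0..t}|lborel. hc (x(d := s)))" by simp
  from box_integrable[OF _ unit_interval_fin_meas this, of "{..<d}"]
  have "set_integrable (vol d) (Omega d) (\<lambda>x. LINT s:{0..t}|lborel. hc (x(d := s)))"
    by (simp add: vol_def Omega_def)
  then show ?thesis
    by (subst set_integrable_cong[OF refl refl, of "Omega d" _ "\<lambda>x. LINT s:{0..t}|lborel. hc (x(d := s))"])
      (use assms line_integral_clamp in auto)
qed

lemma space_time_Fubini:
  assumes t: "t \<in> {0..T}"
  shows "(LINT x:Omega d|vol d. LINT s:{0..t}|lborel. h (x(d := s)))
      = (LINT s:{0..t}|lborel. LINT x:Omega d|vol d. h (x(d := s)))"
    and "(LINT z:Omega_T d T|vol (Suc d). h z)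
      = (LINT s:{0..T}|lborel. LINT x:Omega d|vol d. h (x(d := s)))"
proof -
  \<comment> \<open>The time side is cut at \<open>t\<close>, so that one box argument yields both
    the exchange of integrals up to time \<open>t\<close> and, at \<open>t = T\<close>, the slicing
    of \<open>Omega_T\<close>.\<close>
  define I :: "real \<Rightarrow> nat \<Rightarrow> real set" where "I t i = (if i < d then {0<..<1} else {0..t})" for t i
  have I: "fin_meas (I t)" for t by (auto simp: fin_meas_def I_def emeasure_Icc_finite)
  have ins: "insert d {..<d} = {..<Suc d}" by auto
  have Om: "PiE {..<d} (I t) = Omega d" for t
    unfolding Omega_def by (intro PiE_cong) (auto simp: I_def)
  have Id: "I t d = {0..t}" for t by (simp add: I_def)
  have vold: "PiM {..<d} (\<lambda>_. lborel) = vol d" by (simp add: vol_def)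
  note fub = box_integral_insert[OF finite_lessThan[of d] _ I bdd_borel_clamp[OF T h], of d,
      unfolded ins Om Id vold]
  have "(LINT x:Omega d|vol d. LINT s:{0..t}|lborel. h (x(d := s)))
      = (LINT x:Omega d|vol d. LINT s:{0..t}|lborel. hc (x(d := s)))"
    by (rule set_lebesgue_integral_cong[OF Omega_sets]) (use line_integral_clamp[OF t] in simp)
  also have "\<dots> = (LINT s:{0..t}|lborel. LINT x:Omega d|vol d. hc (x(d := s)))"
    using fub(1)[of t] fub(2)[of t] by simp
  also have "\<dots> = (LINT s:{0..t}|lborel. LINT x:Omega d|vol d. h (x(d := s)))"
    by (rule set_lebesgue_integral_cong) (use slice_integral_clamp t in auto)
  finally show "(LINT x:Omega d|vol d. LINT s:{0..t}|lborel. h (x(d := s)))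
      = (LINT s:{0..t}|lborel. LINT x:Omega d|vol d. h (x(d := s)))" .
  have OT: "Omega_T d T = PiE {..<Suc d} (I T)"
    unfolding Omega_def cyl_eq_PiE I_def ..
  have "(LINT z:Omega_T d T|vol (Suc d). h z) = (LINT z:Omega_T d T|vol (Suc d). hc z)"
    by (rule set_lebesgue_integral_cong[OF Omega_T_sets])
      (use cyl_clamp_id Omega_T_subset_closed in fastforce)
  also have "\<dots> = (LINT s:{0..T}|lborel. LINT x:Omega d|vol d. hc (x(d := s)))"
    using fub(2)[of T] unfolding OT vol_def by simp
  also have "\<dots> = (LINT s:{0..T}|lborel. LINT x:Omega d|vol d. h (x(d := s)))"
    by (rule set_lebesgue_integral_cong) (use slice_integral_clamp in auto)
  finally show "(LINT z:Omega_T d T|vol (Suc d). h z)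
      = (LINT s:{0..T}|lborel. LINT x:Omega d|vol d. h (x(d := s)))" .
qed

text \<open>Cuts a time slice into segments parallel to axis \<open>i\<close>, on which the flux can
  be integrated by the fundamental theorem; the remaining integral is over the face, as in
  \<open>surface_integral\<close>.\<close>

lemma slice_integral_split:
  assumes i: "i < d" and t: "t \<in> {0..T}"
  shows "(LINT x:Omega d|vol d. h (x(d := t)))
    = (LINT y:face_box d i|face_vol d i. LINT r:{0<..<1}|lborel. h (y(i := r, d := t)))"
proof -
  have ins: "insert i ({..<d} - {i}) = {..<d}" using i by auto
  have "(LINT x:Omega d|vol d. h (x(d := t))) = (LINT x:Omega d|vol d. hc (x(d := t)))"
    using slice_integral_clamp[OF t] by simp
  also have "\<dots> = (LINT y:face_box d i|face_vol d i. LINT r:{0<..<1}|lborel. hc (y(i := r, d := t)))"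
    using box_integral_insert(1)[OF _ _ unit_interval_fin_meas bdd_borel_fun_upd[OF bdd_borel_clamp[OF T h]],
        of "{..<d} - {i}" i d t]
    by (simp add: ins Omega_def vol_def del: insert_Diff_single)
  also have "\<dots> = (LINT y:face_box d i|face_vol d i. LINT r:{0<..<1}|lborel. h (y(i := r, d := t)))"
  proof (rule set_lebesgue_integral_cong[OF face_sets], intro allI impI)
    fix y assume y: "y \<in> face_box d i"
    show "(LINT r:{0<..<1}|lborel. hc (y(i := r, d := t))) = (LINT r:{0<..<1}|lborel. h (y(i := r, d := t)))"
      by (rule set_lebesgue_integral_cong) (use face_line_closed[OF T i y _ t] cyl_clamp_id in auto)
  qed
  finally show ?thesis .
qed

end

section \<open>Surface and lateral integrals\<close>

context
  fixes d :: nat and T :: real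
  assumes T: "T > 0"
begin

context
  fixes h :: "(nat \<Rightarrow> real) \<Rightarrow> real" and i :: nat and s :: real
  assumes h: "bdd_cont (bdry_Omega_T d T) h" and i: "i < d" "s \<in> {0, 1}"
begin

abbreviation (input) hf where "hf \<equiv> \<lambda>z. h ((cyl_clamp d T z)(i := s))"

lemma face_integrable:
  assumes "t \<in> {0..T}"
  shows "set_integrable (face_vol d i) (face_box d i) (\<lambda>y. h (y(i := s, d := t)))"
proof -
  have "set_integrable (face_vol d i) (face_box d i) (\<lambda>y. hf (y(d := t)))"
    using box_integrable[OF _ unit_interval_fin_meas bdd_borel_fun_upd[OF bdd_borel_face[OF T h i]], of "{..<d} - {i}" d t]
    by simp
  then show ?thesis
    by (subst set_integrable_cong[OF refl refl, of "face_box d i" _ "\<lambda>y. hf (y(d := t))"])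
      (simp_all only: face_clamp_id[OF i(1) _ assms])
qed

lemma face_time_integrable:
  "set_integrable lborel {0..T} (\<lambda>t. LINT y:face_box d i|face_vol d i. h (y(i := s, d := t)))"
proof -
  have "bdd_borel (\<lambda>t. LINT y:face_box d i|face_vol d i. hf (y(d := t)))"
    by (rule bdd_borel_box_integral[OF _ unit_interval_fin_meas bdd_borel_face[OF T h i]]) simp
  from interval_integrable[OF _ this, of "\<lambda>_. {0..T}" 0]
  have "set_integrable lborel {0..T} (\<lambda>t. LINT y:face_box d i|face_vol d i. hf (y(d := t)))"
    by (simp add: fin_meas_def emeasure_Icc_finite)
  moreover have "(LINT y:face_box d i|face_vol d i. hf (y(d := t)))
     = (LINT y:face_box d i|face_vol d i. h (y(i := s, d := t)))" if "t \<in> {0..T}" for t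
    by (rule set_lebesgue_integral_cong[OF face_sets])
      (intro allI impI, simp only: face_clamp_id[OF i(1) _ that])
  ultimately show ?thesis
    by (subst set_integrable_cong[OF refl refl, of "{0..T}" _ "\<lambda>t. LINT y:face_box d i|face_vol d i. hf (y(d := t))"])
      simp_all
qed

end

lemma surface_time_integrable:
  assumes h: "bdd_cont (bdry_Omega_T d T) h"
  shows "set_integrable lborel {0..T} (\<lambda>t. surface_integral d (\<lambda>x. h (x(d := t))))"
  unfolding surface_integral_def set_integrable_def scaleR_sum_right
  by (intro Bochner_Integration.integrable_sum face_time_integrable[OF h, unfolded set_integrable_def]) auto

lemma surface_mono:
  assumes "bdd_cont (bdry_Omega_T d T) g" "bdd_cont (bdry_Omega_T d T) h"
    and "\<And>z. z \<in> bdry_Omega_T d T \<Longrightarrow> g z \<le> h z" and t: "t \<in> {0..T}"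
  shows "surface_integral d (\<lambda>x. g (x(d := t))) \<le> surface_integral d (\<lambda>x. h (x(d := t)))"
  unfolding surface_integral_def
  by (intro sum_mono set_integral_mono face_integrable assms face_upd_bdry T) auto

lemma lateral_mono:
  assumes "bdd_cont (bdry_Omega_T d T) g" "bdd_cont (bdry_Omega_T d T) h"
    and "\<And>z. z \<in> bdry_Omega_T d T \<Longrightarrow> g z \<le> h z"
  shows "lateral_integral d T g \<le> lateral_integral d T h"
  unfolding lateral_integral_def
  by (intro set_integral_mono surface_time_integrable surface_mono assms)

lemma surface_add:
  assumes g: "bdd_cont (bdry_Omega_T d T) g" and h: "bdd_cont (bdry_Omega_T d T) h" and t: "t \<in> {0..T}"
  shows "surface_integral d (\<lambda>x. g (x(d := t)) + h (x(d := t)))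
    = surface_integral d (\<lambda>x. g (x(d := t))) + surface_integral d (\<lambda>x. h (x(d := t)))"
  unfolding surface_integral_def sum.distrib[symmetric]
  by (intro sum.cong refl set_integral_add face_integrable g h t) auto

lemma lateral_add:
  assumes g: "bdd_cont (bdry_Omega_T d T) g" and h: "bdd_cont (bdry_Omega_T d T) h"
  shows "lateral_integral d T (\<lambda>z. g z + h z) = lateral_integral d T g + lateral_integral d T h"
proof -
  have "lateral_integral d T (\<lambda>z. g z + h z) =
    (LINT t:{0..T}|lborel. surface_integral d (\<lambda>x. g (x(d := t))) + surface_integral d (\<lambda>x. h (x(d := t))))"
    unfolding lateral_integral_def
    by (rule set_lebesgue_integral_cong) (simp_all add: surface_add g h)
  then show ?thesis
    unfolding lateral_integral_def
    by (simp only: set_integral_add(2)[OF surface_time_integrable[OF g] surface_time_integrable[OF h]])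
qed

end

lemma lateral_cmult: "lateral_integral d T (\<lambda>z. c * h z) = c * lateral_integral d T h"
  unfolding lateral_integral_def surface_integral_def
  by (simp add: sum_distrib_left[symmetric])

lemma set_integral_nonneg_on: "(\<And>x. x \<in> A \<Longrightarrow> 0 \<le> f x) \<Longrightarrow> 0 \<le> (LINT x:A|M. f x :: real)"
  unfolding set_lebesgue_integral_def by (intro Bochner_Integration.integral_nonneg) (auto simp: indicator_def)

lemma surface_nonneg:
  "(\<And>i s y. i < d \<Longrightarrow> s \<in> {0, 1} \<Longrightarrow> y \<in> face_box d i \<Longrightarrow> 0 \<le> h (y(i := s)))
    \<Longrightarrow> 0 \<le> surface_integral d h"
  unfolding surface_integral_def by (intro sum_nonneg set_integral_nonneg_on) auto

lemma lateral_nonneg: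
  "(\<And>z. 0 \<le> h z) \<Longrightarrow> 0 \<le> lateral_integral d T h"
  unfolding lateral_integral_def by (intro set_integral_nonneg_on surface_nonneg)

section \<open>Iterated partial derivatives on the closed cylinder\<close>

lemma pd_has_real_derivative:
  assumes "(\<lambda>r. u (z(i := r))) differentiable (at (z i) within I i)"
  shows "((\<lambda>r. u (z(i := r))) has_real_derivative pd I i u z) (at (z i) within I i)"
  using assms unfolding pd_def has_real_derivative_iff_has_vector_derivative vector_derivative_works .

lemma pd_eqI:
  assumes "((\<lambda>r. u (z(i := r))) has_real_derivative c) (at (z i) within I i)"
    and "at (z i) within I i \<noteq> bot"
  shows "pd I i u z = c"
  using assms unfolding pd_def has_real_derivative_iff_has_vector_derivative
  by (metis vector_derivative_within)

lemma pd_diff: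
  assumes "(\<lambda>r. u (z(i := r))) differentiable (at (z i) within I i)"
    and "(\<lambda>r. w (z(i := r))) differentiable (at (z i) within I i)"
    and "at (z i) within I i \<noteq> bot"
  shows "pd I i (\<lambda>z. u z - w z) z = pd I i u z - pd I i w z"
  by (intro pd_eqI DERIV_diff pd_has_real_derivative assms)

lemma D_Cons: "D I (i # w) u = pd I i (D I w u)"
  by (simp add: D_def)

lemma D_Nil: "D I [] u = u"
  by (simp add: D_def)

text \<open>A connected set with more than one point has no isolated points. This makes derivatives
  within a side unique, also at its end points, which every computation of \<open>pd\<close> relies
  on.\<close>

lemma side_nontrivial:
  assumes "T > 0" "x \<in> side d T i"
  shows "at x within side d T i \<noteq> bot"
proof -
  define b where "b = (if i < d then 1 else T)"
  have s: "side d T i = {0..b}" "b > 0" using assms by (auto simp: side_def b_def)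
  have "\<not> (\<exists>y. {0..b} = {y})"
  proof
    assume "\<exists>y. {0..b} = {y}"
    then obtain y where y: "{0..b} = {y}" by blast
    have "0 \<in> {0..b}" "b \<in> {0..b}" using s by auto
    then show False unfolding y using s by auto
  qed
  then have "x islimpt {0..b}" using assms s by (intro connected_imp_perfect) auto
  then show ?thesis by (simp add: s trivial_limit_within)
qed

lemma C_class_has_real_derivative:
  assumes "C_class I n s S u" "i # w \<in> dwords n s" "z \<in> S"
  shows "((\<lambda>r. D I w u (z(i := r))) has_real_derivative D I (i # w) u z) (at (z i) within I i)"
  unfolding D_Cons using assms by (intro pd_has_real_derivative) (auto simp: C_class_def)

lemma C_norm_finite:
  assumes "C_norm I n s S u < \<infinity>"
  shows "C_class I n s S u" and "w \<in> dwords n s \<Longrightarrow> bdd_cont S (D I w u)"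
proof -
  show C: "C_class I n s S u" using assms by (auto simp: C_norm_def split: if_splits)
  assume w: "w \<in> dwords n s"
  have "\<bar>D I w u z\<bar> \<le> enn2real (C_norm I n s S u)" if z: "z \<in> S" for z
  proof -
    have "ennreal \<bar>D I w u z\<bar> \<le> (SUP z\<in>S. ennreal \<bar>D I w u z\<bar>)" using z by (rule SUP_upper)
    also have "\<dots> \<le> C_norm I n s S u" unfolding C_norm_def if_P[OF C] using w by (rule SUP_upper)
    finally show ?thesis using assms by (metis abs_ge_zero enn2real_ennreal enn2real_mono infinity_ennreal_def)
  qed
  then show "bdd_cont S (D I w u)" using C w unfolding bdd_cont_def C_class_def by blast
qed

lemma dwords_ConsD: "i # w \<in> dwords n s \<Longrightarrow> w \<in> dwords n s" "i # w \<in> dwords n s \<Longrightarrow> i < n"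
  by (auto simp: dwords_def)

text \<open>Linearity holds on the cylinder only, and that suffices for the induction on the word:
  varying coordinate \<open>i\<close> within its side stays in the cylinder, so the induction
  hypothesis may be substituted under the next derivative.\<close>

lemma D_diff_cyl:
  assumes T: "T > 0"
    and u: "C_class (side d T) (Suc d) s (closed_Omega_T d T) u"
    and v: "C_class (side d T) (Suc d) s (closed_Omega_T d T) v"
  shows "w \<in> dwords (Suc d) s \<Longrightarrow> z \<in> closed_Omega_T d T \<Longrightarrow>
    D (side d T) w (\<lambda>z. u z - v z) z = D (side d T) w u z - D (side d T) w v z"
proof (induction w arbitrary: z)
  case Nil
  then show ?case by (simp add: D_Nil)
next
  case (Cons i w)
  note iw = dwords_ConsD[OF Cons.prems(1)]
  have zi: "z i \<in> side d T i" by (rule closed_cyl_coord[OF Cons.prems(2) iw(2)])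
  have "((\<lambda>r. D (side d T) w u (z(i := r)) - D (side d T) w v (z(i := r))) has_real_derivative
      D (side d T) (i # w) u z - D (side d T) (i # w) v z) (at (z i) within side d T i)"
    by (intro DERIV_diff C_class_has_real_derivative[OF u] C_class_has_real_derivative[OF v] Cons.prems)
  then
  have "((\<lambda>r. D (side d T) w (\<lambda>z. u z - v z) (z(i := r))) has_real_derivative
      D (side d T) (i # w) u z - D (side d T) (i # w) v z) (at (z i) within side d T i)"
    by (rule has_field_derivative_transform_within[OF _ zero_less_one zi])
      (simp only: Cons.IH[OF iw(1) closed_cyl_upd[OF Cons.prems(2) iw(2)]])
  then show ?case unfolding D_Cons
    by (intro pd_eqI side_nontrivial[OF T zi]) (simp only: D_Cons)
qed

lemma C_class_diff_cyl:
  assumes T: "T > 0"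
    and u: "C_class (side d T) (Suc d) s (closed_Omega_T d T) u"
    and v: "C_class (side d T) (Suc d) s (closed_Omega_T d T) v"
  shows "C_class (side d T) (Suc d) s (closed_Omega_T d T) (\<lambda>z. u z - v z)"
  unfolding C_class_def
proof (intro conjI ballI allI impI)
  fix w assume w: "w \<in> dwords (Suc d) s"
  have "continuous_on (closed_Omega_T d T) (\<lambda>z. D (side d T) w u z - D (side d T) w v z)"
    using u v w by (intro continuous_on_diff) (auto simp: C_class_def)
  then show "continuous_on (closed_Omega_T d T) (D (side d T) w (\<lambda>z. u z - v z))"
    using D_diff_cyl[OF T u v w] by (subst continuous_on_cong[OF refl]) auto
next
  fix w i z assume iw: "i # w \<in> dwords (Suc d) s" and z: "z \<in> closed_Omega_T d T"
  note iw' = dwords_ConsD[OF iw]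
  have zi: "z i \<in> side d T i" by (rule closed_cyl_coord[OF z iw'(2)])
  have "((\<lambda>r. D (side d T) w u (z(i := r)) - D (side d T) w v (z(i := r))) has_real_derivative
      D (side d T) (i # w) u z - D (side d T) (i # w) v z) (at (z i) within side d T i)"
    by (intro DERIV_diff C_class_has_real_derivative[OF u] C_class_has_real_derivative[OF v] iw z)
  then
  have "((\<lambda>r. D (side d T) w (\<lambda>z. u z - v z) (z(i := r))) has_real_derivative
      D (side d T) (i # w) u z - D (side d T) (i # w) v z) (at (z i) within side d T i)"
    by (rule has_field_derivative_transform_within[OF _ zero_less_one zi])
      (simp only: D_diff_cyl[OF T u v iw'(1) closed_cyl_upd[OF z iw'(2)]])
  then show "(\<lambda>r. D (side d T) w (\<lambda>z. u z - v z) (z(i := r))) differentiable (at (z i) within side d T i)"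
    unfolding has_field_derivative_def differentiable_def by blast
qed

text \<open>In the interior of both ranges, derivatives within the sides are ordinary two-sided
  ones, so Schwarz's theorem applies to the plane section in the variables \<open>i\<close> and
  \<open>d\<close>.\<close>

lemma D_symmetric:
  assumes v: "C_class (side d T) (Suc d) 2 (closed_Omega_T d T) v"
    and z: "z \<in> closed_Omega_T d T" and i: "i < d" "z i \<in> {0<..<1}" "z d \<in> {0<..<T}"
  shows "D (side d T) [d, i] v z = D (side d T) [i, d] v z"
proof -
  let ?D = "D (side d T)"
  define p where "p x y = z(i := x, d := y)" for x y
  have p_in: "p x y \<in> closed_Omega_T d T" if "x \<in> {0<..<1}" "y \<in> {0<..<T}" for x y
  proof -
    have "z(i := x) \<in> closed_Omega_T d T"
      by (rule closed_cyl_upd[OF z]) (use i that in \<open>auto simp: side_def\<close>)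
    then show ?thesis unfolding p_def
      by (rule closed_cyl_upd) (use that in \<open>auto simp: side_def\<close>)
  qed
  have wd: "w \<in> dwords (Suc d) 2" if "w \<in> {[i], [d], [d, i], [i, d]}" for w
    using that i by (auto simp: dwords_def)
  have dx: "((\<lambda>x. ?D w v (p x y)) has_real_derivative ?D (i # w) v (p x y)) (at x)"
    if "x \<in> {0<..<1}" "y \<in> {0<..<T}" "i # w \<in> dwords (Suc d) 2" for x y w
  proof -
    have e: "(p x y)(i := r) = p r y" "p x y i = x" for r
      using i by (simp_all add: p_def fun_upd_twist)
    have "((\<lambda>x. ?D w v (p x y)) has_real_derivative ?D (i # w) v (p x y)) (at x within {0..1})"
      using C_class_has_real_derivative[OF v that(3) p_in[OF that(1,2)], unfolded e] i by (simp add: side_def)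
    moreover have "at x within {0..1} = at x" by (rule at_within_Icc_at) (use that in auto)
    ultimately show ?thesis by simp
  qed
  have dy: "((\<lambda>y. ?D w v (p x y)) has_real_derivative ?D (d # w) v (p x y)) (at y)"
    if "x \<in> {0<..<1}" "y \<in> {0<..<T}" "d # w \<in> dwords (Suc d) 2" for x y w
  proof -
    have e: "(p x y)(d := r) = p x r" "p x y d = y" for r
      using i by (simp_all add: p_def)
    have "((\<lambda>y. ?D w v (p x y)) has_real_derivative ?D (d # w) v (p x y)) (at y within {0..T})"
      using C_class_has_real_derivative[OF v that(3) p_in[OF that(1,2)], unfolded e] by (simp add: side_def)
    moreover have "at y within {0..T} = at y" by (rule at_within_Icc_at) (use that in auto)
    ultimately show ?thesis by simp
  qed
  have cont: "isCont (\<lambda>(x, y). ?D w v (p x y)) (z i, z d)" if w: "w \<in> dwords (Suc d) 2" for w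
  proof -
    have "continuous_on ({0<..<1} \<times> {0<..<T}) (\<lambda>q. ?D w v (p (fst q) (snd q)))"
    proof (rule continuous_on_compose2[where g="?D w v" and f="\<lambda>q. p (fst q) (snd q)"])
      show "continuous_on (closed_Omega_T d T) (?D w v)" using v w by (simp add: C_class_def)
      show "continuous_on ({0<..<1} \<times> {0<..<T}) (\<lambda>q. p (fst q) (snd q))"
        unfolding p_def
        by (intro continuous_on_fun_upd continuous_on_const continuous_on_fst continuous_on_snd continuous_on_id)
    qed (use p_in in auto)
    moreover have "open ({0<..<1} \<times> {0<..<T} :: (real \<times> real) set)" by (intro open_Times open_greaterThanLessThan)
    moreover have "(z i, z d) \<in> {0<..<1} \<times> {0<..<T}" using i by simp
    ultimately show ?thesis
      unfolding case_prod_beta using continuous_on_eq_continuous_at by blast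
  qed
  have d: "((\<lambda>x. v (p x y)) has_real_derivative ?D [i] v (p x y)) (at x)"
    "((\<lambda>y. v (p x y)) has_real_derivative ?D [d] v (p x y)) (at y)"
    if "x \<in> {0<..<1}" "y \<in> {0<..<T}" for x y
    using dx[OF that, of "[]"] dy[OF that, of "[]"] wd by (simp_all add: D_Nil)
  have "?D [d, i] v (p (z i) (z d)) = ?D [i, d] v (p (z i) (z d))"
    by (rule mixed_partials_eq[where f="\<lambda>x y. v (p x y)" and fx="\<lambda>x y. ?D [i] v (p x y)"
        and fy="\<lambda>x y. ?D [d] v (p x y)" and fxy="\<lambda>x y. ?D [d, i] v (p x y)"
        and fyx="\<lambda>x y. ?D [i, d] v (p x y)" and S="{0<..<1}" and S'="{0<..<T}"])
      (use i d dx[of _ _ "[d]"] dy[of _ _ "[i]"] wd cont in auto)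
  then show ?thesis by (simp add: p_def)
qed

section \<open>The energy density and its pointwise growth\<close>

definition energy_density :: "nat \<Rightarrow> real \<Rightarrow> ((nat \<Rightarrow> real) \<Rightarrow> real) \<Rightarrow> (nat \<Rightarrow> real) \<Rightarrow> real" where
  "energy_density d T v z =
     (v z)\<^sup>2 + (D (side d T) [d] v z)\<^sup>2 + (\<Sum>i<d. (D (side d T) [i] v z)\<^sup>2)"

definition grad_sq :: "nat \<Rightarrow> real \<Rightarrow> ((nat \<Rightarrow> real) \<Rightarrow> real) \<Rightarrow> (nat \<Rightarrow> real) \<Rightarrow> real" where
  "grad_sq d T v z = (D (side d T) [d] v z)\<^sup>2 + (\<Sum>i<d. (D (side d T) [i] v z)\<^sup>2)"

text \<open>The summand d_i (v_t * d_i v) of the divergence, expanded by the product rule.\<close>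

definition flux_div :: "nat \<Rightarrow> real \<Rightarrow> ((nat \<Rightarrow> real) \<Rightarrow> real) \<Rightarrow> nat \<Rightarrow> (nat \<Rightarrow> real) \<Rightarrow> real" where
  "flux_div d T v i z = D (side d T) [i, d] v z * D (side d T) [i] v z
     + D (side d T) [d] v z * D (side d T) [i, i] v z"

text \<open>At interior points, the time derivative of exp(-2 t) e. The mixed derivatives are
  written in the order \<open>[i, d]\<close>, as they occur in \<open>flux_div\<close>, instead of
  the order \<open>[d, i]\<close> that differentiation produces.\<close>

definition energy_rate :: "nat \<Rightarrow> real \<Rightarrow> ((nat \<Rightarrow> real) \<Rightarrow> real) \<Rightarrow> (nat \<Rightarrow> real) \<Rightarrow> real" where
  "energy_rate d T v z = exp (- 2 * z d) *
     (2 * v z * D (side d T) [d] v z + 2 * D (side d T) [d] v z * D (side d T) [d, d] v z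
      + (\<Sum>i<d. 2 * D (side d T) [i] v z * D (side d T) [i, d] v z) - 2 * energy_density d T v z)"

definition energy_rate_bound :: "nat \<Rightarrow> real \<Rightarrow> ((nat \<Rightarrow> real) \<Rightarrow> real) \<Rightarrow> (nat \<Rightarrow> real) \<Rightarrow> real" where
  "energy_rate_bound d T v z =
     exp (- 2 * z d) * ((wave_op d T v z)\<^sup>2 + 2 * (\<Sum>i<d. flux_div d T v i z))"

text \<open>Replacing v_tt by r + Lap v leaves two terms to estimate: 2 v v_t <= v^2 + v_t^2 and 2
  v_t r <= v_t^2 + r^2. Their sum is at most 2 e + r^2, and the weight contributes exactly -2
  e.\<close>

lemma energy_rate_le: "energy_rate d T v z \<le> energy_rate_bound d T v z"
proof -
  let ?D = "D (side d T)"
  define r where "r = wave_op d T v z"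
  have dd: "?D [d, d] v z = r + (\<Sum>i<d. ?D [i, i] v z)" by (simp add: r_def wave_op_def)
  \<comment> \<open>All terms with second spatial or mixed derivatives combine into the divergence
    exactly, without any estimate.\<close>
  have s: "(\<Sum>i<d. 2 * ?D [i] v z * ?D [i, d] v z) + 2 * ?D [d] v z * (\<Sum>i<d. ?D [i, i] v z)
      = 2 * (\<Sum>i<d. flux_div d T v i z)"
    by (simp add: flux_div_def sum_distrib_left sum.distrib algebra_simps)
  have "2 * v z * ?D [d] v z \<le> (v z)\<^sup>2 + (?D [d] v z)\<^sup>2" by (rule sum_squares_bound)
  moreover have "2 * ?D [d] v z * r \<le> (?D [d] v z)\<^sup>2 + r\<^sup>2" by (rule sum_squares_bound)
  moreover have "(v z)\<^sup>2 + (?D [d] v z)\<^sup>2 \<le> energy_density d T v z"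
    by (simp add: energy_density_def sum_nonneg)
  moreover have "0 \<le> (v z)\<^sup>2" by simp
  ultimately have "2 * v z * ?D [d] v z + 2 * ?D [d] v z * r - 2 * energy_density d T v z \<le> r\<^sup>2"
    by linarith
  then have "2 * v z * ?D [d] v z + 2 * ?D [d] v z * ?D [d, d] v z
      + (\<Sum>i<d. 2 * ?D [i] v z * ?D [i, d] v z) - 2 * energy_density d T v z
      \<le> r\<^sup>2 + 2 * (\<Sum>i<d. flux_div d T v i z)"
    unfolding dd s[symmetric] by (simp add: distrib_left)
  then show ?thesis
    unfolding energy_rate_def energy_rate_bound_def r_def by (intro mult_left_mono) auto
qed

lemma bdd_cont_time_weight:
  assumes "T > 0"
  shows "bdd_cont (closed_Omega_T d T) (\<lambda>z. exp (- 2 * z d))"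
  unfolding bdd_cont_def
proof (intro conjI exI ballI)
  show "continuous_on (closed_Omega_T d T) (\<lambda>z. exp (- 2 * z d))"
    by (intro continuous_on_exp continuous_on_mult continuous_on_const
        continuous_on_product_then_coordinatewise[OF continuous_on_id])
  fix z assume "z \<in> closed_Omega_T d T"
  then have "z d \<in> side d T d" by (rule closed_cyl_coord) simp
  then show "\<bar>exp (- 2 * z d)\<bar> \<le> 1" by (simp add: side_def)
qed

lemma set_integral_subset_mono:
  fixes f :: "'a \<Rightarrow> real"
  assumes "set_integrable M B f" "A \<in> sets M" "A \<subseteq> B" "\<And>x. 0 \<le> f x"
  shows "(LINT x:A|M. f x) \<le> (LINT x:B|M. f x)"
  using set_integrable_subset[OF assms(1-3)] assms
  unfolding set_lebesgue_integral_def set_integrable_def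
  by (intro integral_mono) (auto simp: indicator_def)

section \<open>The weighted energy estimate for a \<open>C\<^sup>2\<close> function with bounded
  derivatives\<close>

context
  fixes d :: nat and T :: real and v :: "(nat \<Rightarrow> real) \<Rightarrow> real"
  assumes T: "T > 0"
    and v: "C_class (side d T) (Suc d) 2 (closed_Omega_T d T) v"
    and b: "\<And>w. w \<in> dwords (Suc d) 2 \<Longrightarrow> bdd_cont (closed_Omega_T d T) (D (side d T) w v)"
begin

lemma bdd_cont_D:
  "bdd_cont (closed_Omega_T d T) v"
  "i < Suc d \<Longrightarrow> bdd_cont (closed_Omega_T d T) (D (side d T) [i] v)"
  "i < Suc d \<Longrightarrow> j < Suc d \<Longrightarrow> bdd_cont (closed_Omega_T d T) (D (side d T) [i, j] v)"
  using b[of "[]"] b[of "[i]"] b[of "[i, j]"] by (auto simp: dwords_def D_Nil)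

lemma bdd_cont_energy:
  "bdd_cont (closed_Omega_T d T) (energy_density d T v)"
  "bdd_cont (closed_Omega_T d T) (grad_sq d T v)"
  "bdd_cont (closed_Omega_T d T) (\<lambda>z. (wave_op d T v z)\<^sup>2)"
  "i < d \<Longrightarrow> bdd_cont (closed_Omega_T d T) (flux_div d T v i)"
proof -
  show "bdd_cont (closed_Omega_T d T) (energy_density d T v)"
    unfolding energy_density_def by (intro bdd_cont_intros bdd_cont_D) auto
  show "bdd_cont (closed_Omega_T d T) (grad_sq d T v)"
    unfolding grad_sq_def by (intro bdd_cont_intros bdd_cont_D) auto
  show "bdd_cont (closed_Omega_T d T) (\<lambda>z. (wave_op d T v z)\<^sup>2)"
    unfolding wave_op_def by (intro bdd_cont_intros bdd_cont_D) auto
  show "bdd_cont (closed_Omega_T d T) (flux_div d T v i)" if "i < d"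
    unfolding flux_div_def using that by (intro bdd_cont_intros bdd_cont_D) auto
qed

lemma bdd_cont_energy_rate:
  "bdd_cont (closed_Omega_T d T) (energy_rate d T v)"
  "bdd_cont (closed_Omega_T d T) (energy_rate_bound d T v)"
proof -
  show "bdd_cont (closed_Omega_T d T) (energy_rate d T v)"
    unfolding energy_rate_def
    by (intro bdd_cont_intros bdd_cont_D bdd_cont_energy bdd_cont_time_weight T) auto
  show "bdd_cont (closed_Omega_T d T) (energy_rate_bound d T v)"
    unfolding energy_rate_bound_def
    by (intro bdd_cont_add bdd_cont_mult bdd_cont_const bdd_cont_sum bdd_cont_energy bdd_cont_time_weight T) auto
qed

lemma time_line_continuous:
  assumes "bdd_cont (closed_Omega_T d T) h" "x \<in> Omega d" "t \<in> {0..T}"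
  shows "continuous_on {0..t} (\<lambda>s. h (x(d := s)))"
proof (rule continuous_on_compose2[where g=h and f="\<lambda>s. x(d := s)"])
  show "continuous_on (closed_Omega_T d T) h" using assms by (simp add: bdd_cont_def)
  show "continuous_on {0..t} (\<lambda>s. x(d := s))"
    by (intro continuous_on_fun_upd continuous_on_const continuous_on_id)
qed (use assms Omega_upd_closed_cyl in auto)

lemma time_derivative:
  assumes x: "x \<in> Omega d" and s: "s \<in> {0<..<T}" and w: "d # w \<in> dwords (Suc d) 2"
  shows "((\<lambda>r. D (side d T) w v (x(d := r))) has_real_derivative D (side d T) (d # w) v (x(d := s))) (at s)"
proof -
  have "x(d := s) \<in> closed_Omega_T d T" using s by (intro Omega_upd_closed_cyl x) auto
  from C_class_has_real_derivative[OF v w this]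
  have "((\<lambda>r. D (side d T) w v (x(d := r))) has_real_derivative D (side d T) (d # w) v (x(d := s))) (at s within {0..T})"
    by (simp add: side_def)
  moreover have "at s within {0..T} = at s" by (rule at_within_Icc_at) (use s in auto)
  ultimately show ?thesis by simp
qed

lemma energy_derivative:
  assumes x: "x \<in> Omega d" and s: "s \<in> {0<..<T}"
  shows "((\<lambda>s. exp (- 2 * s) * energy_density d T v (x(d := s))) has_real_derivative
      energy_rate d T v (x(d := s))) (at s)"
proof -
  let ?D = "D (side d T)"
  let ?z = "x(d := s)"
  have sq: "((\<lambda>s. (f s)\<^sup>2) has_real_derivative 2 * f s * f') (at s)"
    if "(f has_real_derivative f') (at s)" for f f'
    using DERIV_power[OF that, of 2] by (simp add: mult_ac)
  have z: "?z \<in> closed_Omega_T d T" using s by (intro Omega_upd_closed_cyl x) auto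
  \<comment> \<open>Differentiating the square of d_i v in time produces the order
    \<open>[d, i]\<close>; the exchange is available because \<open>x\<close> lies in the open cube
    and \<open>s\<close> strictly between 0 and \<open>T\<close>.\<close>
  have sym: "?D [d, i] v ?z = ?D [i, d] v ?z" if "i < d" for i
  proof (rule D_symmetric[OF v z that])
    show "?z i \<in> {0<..<1}" using x that PiE_mem[of x "{..<d}" "\<lambda>_. {0<..<1}" i] by (simp add: Omega_def)
    show "?z d \<in> {0<..<T}" using s by simp
  qed
  have 0: "((\<lambda>s. v (x(d := s))) has_real_derivative ?D [d] v ?z) (at s)"
    using time_derivative[OF x s, of "[]"] by (simp add: dwords_def D_Nil)
  have 1: "((\<lambda>s. ?D [d] v (x(d := s))) has_real_derivative ?D [d, d] v ?z) (at s)"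
    using time_derivative[OF x s, of "[d]"] by (simp add: dwords_def)
  have 2: "((\<lambda>s. ?D [i] v (x(d := s))) has_real_derivative ?D [i, d] v ?z) (at s)" if "i < d" for i
    using time_derivative[OF x s, of "[i]"] that by (simp add: dwords_def sym)
  have "((\<lambda>s. \<Sum>i<d. (?D [i] v (x(d := s)))\<^sup>2) has_real_derivative
      (\<Sum>i<d. 2 * ?D [i] v ?z * ?D [i, d] v ?z)) (at s)"
    by (intro DERIV_sum sq 2) auto
  from DERIV_add[OF DERIV_add[OF sq[OF 0] sq[OF 1]] this]
  have e: "((\<lambda>s. energy_density d T v (x(d := s))) has_real_derivative
      2 * v ?z * ?D [d] v ?z + 2 * ?D [d] v ?z * ?D [d, d] v ?z
      + (\<Sum>i<d. 2 * ?D [i] v ?z * ?D [i, d] v ?z)) (at s)"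
    unfolding energy_density_def .
  have "((\<lambda>s :: real. exp (- 2 * s)) has_real_derivative - 2 * exp (- 2 * s)) (at s)"
    by (auto intro!: derivative_eq_intros)
  from DERIV_mult[OF this e] show ?thesis
    by (rule DERIV_cong) (simp add: energy_rate_def algebra_simps)
qed

lemma energy_line_integral:
  assumes x: "x \<in> Omega d" and t: "t \<in> {0..T}"
  shows "(LINT s:{0..t}|lborel. energy_rate d T v (x(d := s)))
    = exp (- 2 * t) * energy_density d T v (x(d := t)) - energy_density d T v (x(d := 0))"
proof -
  have "(LINT s:{0..t}|lborel. energy_rate d T v (x(d := s)))
    = exp (- 2 * t) * energy_density d T v (x(d := t)) - exp (- 2 * 0) * energy_density d T v (x(d := 0))"
  proof (rule set_integral_FTC(1))
    show "continuous_on {0..t} (\<lambda>s. exp (- 2 * s) * energy_density d T v (x(d := s)))"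
      by (intro continuous_on_mult continuous_on_exp continuous_on_const continuous_on_id
          time_line_continuous[OF bdd_cont_energy(1) x t])
    show "continuous_on {0..t} (\<lambda>s. energy_rate d T v (x(d := s)))"
      by (rule time_line_continuous[OF bdd_cont_energy_rate(1) x t])
    show "((\<lambda>s. exp (- 2 * s) * energy_density d T v (x(d := s))) has_real_derivative
        energy_rate d T v (x(d := s))) (at s)" if "s \<in> {0<..<t}" for s
      by (rule energy_derivative[OF x]) (use that t in auto)
  qed (use t in simp)
  then show ?thesis by simp
qed

lemma flux_line_integral:
  assumes i: "i < d" and y: "y \<in> face_box d i" and t: "t \<in> {0..T}"
  shows "(LINT r:{0<..<1}|lborel. flux_div d T v i (y(i := r, d := t)))
    = D (side d T) [d] v (y(i := 1, d := t)) * D (side d T) [i] v (y(i := 1, d := t))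
      - D (side d T) [d] v (y(i := 0, d := t)) * D (side d T) [i] v (y(i := 0, d := t))"
proof -
  let ?D = "D (side d T)"
  have q: "y(i := r, d := t) \<in> closed_Omega_T d T" if "r \<in> {0..1}" for r
    by (rule face_line_closed[OF T i y that t])
  have cont: "continuous_on {0..1} (\<lambda>r. h (y(i := r, d := t)))" if "bdd_cont (closed_Omega_T d T) h" for h
  proof (rule continuous_on_compose2[where g=h and f="\<lambda>r. y(i := r, d := t)"])
    show "continuous_on (closed_Omega_T d T) h" using that by (simp add: bdd_cont_def)
    show "continuous_on {0..1} (\<lambda>r. y(i := r, d := t))"
      by (intro continuous_on_fun_upd continuous_on_const continuous_on_id)
  qed (use q in auto)
  have deriv: "((\<lambda>r. ?D w v (y(i := r, d := t))) has_real_derivative ?D (i # w) v (y(i := r, d := t))) (at r)"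
    if w: "i # w \<in> dwords (Suc d) 2" and r: "r \<in> {0<..<1}" for w r
  proof -
    have e: "(y(i := r, d := t))(i := r') = y(i := r', d := t)" "(y(i := r, d := t)) i = r" for r'
      using i by (simp_all add: fun_upd_twist)
    have "y(i := r, d := t) \<in> closed_Omega_T d T" by (rule q) (use r in auto)
    from C_class_has_real_derivative[OF v w this, unfolded e]
    have "((\<lambda>r. ?D w v (y(i := r, d := t))) has_real_derivative ?D (i # w) v (y(i := r, d := t))) (at r within {0..1})"
      using i by (simp add: side_def)
    moreover have "at r within {0..1} = at r" by (rule at_within_Icc_at) (use r in auto)
    ultimately show ?thesis by simp
  qed
  have w: "[i, d] \<in> dwords (Suc d) 2" "[i, i] \<in> dwords (Suc d) 2" using i by (auto simp: dwords_def)
  show ?thesis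
  proof (rule set_integral_FTC(2))
    show "continuous_on {0..1} (\<lambda>r. ?D [d] v (y(i := r, d := t)) * ?D [i] v (y(i := r, d := t)))"
      using i by (intro continuous_on_mult cont bdd_cont_D) auto
    show "continuous_on {0..1} (\<lambda>r. flux_div d T v i (y(i := r, d := t)))"
      by (rule cont[OF bdd_cont_energy(4)[OF i]])
    show "((\<lambda>r. ?D [d] v (y(i := r, d := t)) * ?D [i] v (y(i := r, d := t))) has_real_derivative
        flux_div d T v i (y(i := r, d := t))) (at r)" if "r \<in> {0<..<1}" for r
      using DERIV_mult[OF deriv[OF w(1) that] deriv[OF w(2) that]]
      by (rule DERIV_cong) (simp add: flux_div_def algebra_simps)
  qed simp
qed

text \<open>Along each segment the fundamental theorem leaves v_t * d_i v at the face
  \<open>s = 1\<close> minus its value at the face \<open>s = 0\<close>. The factor 2 on the left is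
  the one in 2 |a b| <= a^2 + b^2, so each face costs one \<open>grad_sq\<close>, and the sum over
  both is dominated by summand \<open>i\<close> of the surface integral.\<close>

lemma flux_bound:
  assumes i: "i < d" and t: "t \<in> {0..T}"
  shows "2 * (LINT x:Omega d|vol d. flux_div d T v i (x(d := t)))
    \<le> (\<Sum>s\<in>{0, 1}. LINT y:face_box d i|face_vol d i. grad_sq d T v (y(i := s, d := t)))"
proof -
  let ?D = "D (side d T)"
  let ?m = "\<lambda>z. ?D [d] v z * ?D [i] v z"
  have m: "bdd_cont (bdry_Omega_T d T) ?m" "bdd_cont (bdry_Omega_T d T) (grad_sq d T v)"
    using i by (auto intro!: bdd_cont_subset[OF _ bdry_subset_closed] bdd_cont_mult bdd_cont_D bdd_cont_energy)
  have m_int: "set_integrable (face_vol d i) (face_box d i) (\<lambda>y. ?m (y(i := s, d := t)))"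
    and k_int: "set_integrable (face_vol d i) (face_box d i) (\<lambda>y. grad_sq d T v (y(i := s, d := t)))"
    if "s \<in> {0, 1}" for s
    using face_integrable[OF T _ i that t] m by blast+
  have mk: "2 * \<bar>?m z\<bar> \<le> grad_sq d T v z" for z
  proof -
    have "(?D [i] v z)\<^sup>2 \<le> (\<Sum>i<d. (?D [i] v z)\<^sup>2)"
      using i by (intro member_le_sum) auto
    moreover have "2 * \<bar>?D [d] v z\<bar> * \<bar>?D [i] v z\<bar> \<le> \<bar>?D [d] v z\<bar>\<^sup>2 + \<bar>?D [i] v z\<bar>\<^sup>2"
      by (rule sum_squares_bound)
    ultimately show ?thesis by (simp add: grad_sq_def abs_mult)
  qed
  have aux: "2 * \<bar>a\<bar> \<le> p \<Longrightarrow> 2 * \<bar>b\<bar> \<le> q \<Longrightarrow> 2 * (a - b) \<le> q + p" for a b p q :: real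
    using abs_ge_self[of a] abs_ge_minus_self[of b] by argo
  have "2 * (LINT x:Omega d|vol d. flux_div d T v i (x(d := t)))
      = 2 * (LINT y:face_box d i|face_vol d i. LINT r:{0<..<1}|lborel. flux_div d T v i (y(i := r, d := t)))"
    by (simp only: slice_integral_split[OF T bdd_cont_energy(4)[OF i] i t])
  also have "\<dots> = 2 * (LINT y:face_box d i|face_vol d i. ?m (y(i := 1, d := t)) - ?m (y(i := 0, d := t)))"
    by (intro arg_cong[where f="\<lambda>x. 2 * x"] set_lebesgue_integral_cong[OF face_sets] allI impI flux_line_integral i t)
  also have "\<dots> = (LINT y:face_box d i|face_vol d i. 2 * (?m (y(i := 1, d := t)) - ?m (y(i := 0, d := t))))"
    by (rule set_integral_mult_right[symmetric])
  also have "\<dots> \<le> (LINT y:face_box d i|face_vol d i.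
      grad_sq d T v (y(i := 0, d := t)) + grad_sq d T v (y(i := 1, d := t)))"
  proof (rule set_integral_mono)
    show "set_integrable (face_vol d i) (face_box d i)
        (\<lambda>y. 2 * (?m (y(i := 1, d := t)) - ?m (y(i := 0, d := t))))"
      using m_int by (intro set_integrable_mult_right set_integral_diff) auto
    show "set_integrable (face_vol d i) (face_box d i)
        (\<lambda>y. grad_sq d T v (y(i := 0, d := t)) + grad_sq d T v (y(i := 1, d := t)))"
      using k_int by (intro set_integral_add) auto
    show "2 * (?m (y(i := 1, d := t)) - ?m (y(i := 0, d := t)))
      \<le> grad_sq d T v (y(i := 0, d := t)) + grad_sq d T v (y(i := 1, d := t))" for y
      by (rule aux[OF mk mk])
  qed
  also have "\<dots> = (\<Sum>s\<in>{0, 1}. LINT y:face_box d i|face_vol d i. grad_sq d T v (y(i := s, d := t)))"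
    using set_integral_add(2)[OF k_int[of 0] k_int[of 1]] by simp
  finally show ?thesis .
qed

text \<open>At a fixed time the weight is a constant, so it leaves the integral and the divergence
  can be integrated over the unweighted slice.\<close>

lemma slice_rate_bound:
  assumes s: "s \<in> {0..T}"
  shows "(LINT x:Omega d|vol d. energy_rate_bound d T v (x(d := s)))
    \<le> (LINT x:Omega d|vol d. (wave_op d T v (x(d := s)))\<^sup>2)
      + surface_integral d (\<lambda>x. grad_sq d T v (x(d := s)))"
proof -
  let ?L = "\<lambda>h. LINT x:Omega d|vol d. h (x(d := s))"
  let ?W = "?L (\<lambda>z. (wave_op d T v z)\<^sup>2)"
  have int_f: "set_integrable (vol d) (Omega d) (\<lambda>x. flux_div d T v i (x(d := s)))" if "i < d" for i
    by (rule slice_integrable[OF T bdd_cont_energy(4)[OF that] s])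
  have int_w: "set_integrable (vol d) (Omega d) (\<lambda>x. (wave_op d T v (x(d := s)))\<^sup>2)"
    by (rule slice_integrable[OF T bdd_cont_energy(3) s])
  have int_sum: "set_integrable (vol d) (Omega d) (\<lambda>x. \<Sum>i<d. flux_div d T v i (x(d := s)))"
    by (intro slice_integrable[OF T _ s] bdd_cont_sum bdd_cont_energy) auto
  have sum: "?L (\<lambda>z. \<Sum>i<d. flux_div d T v i z) = (\<Sum>i<d. ?L (flux_div d T v i))"
    unfolding set_lebesgue_integral_def scaleR_sum_right
    by (intro Bochner_Integration.integral_sum) (use int_f in \<open>simp add: set_integrable_def\<close>)
  have "?L (energy_rate_bound d T v)
      = exp (- 2 * s) * ?L (\<lambda>z. (wave_op d T v z)\<^sup>2 + 2 * (\<Sum>i<d. flux_div d T v i z))"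
    unfolding energy_rate_bound_def by simp
  also have "\<dots> = exp (- 2 * s) * (?W + 2 * ?L (\<lambda>z. \<Sum>i<d. flux_div d T v i z))"
    using set_integral_add(2)[OF int_w set_integrable_mult_right[OF int_sum, of 2]] by simp
  also have "\<dots> = exp (- 2 * s) * (?W + (\<Sum>i<d. 2 * ?L (flux_div d T v i)))"
    by (simp only: sum sum_distrib_left)
  also have "\<dots> \<le> exp (- 2 * s) * (?W + surface_integral d (\<lambda>x. grad_sq d T v (x(d := s))))"
    unfolding surface_integral_def
    by (intro mult_left_mono add_left_mono sum_mono flux_bound s) auto
  \<comment> \<open>The weight is dropped only here: the flux integrals have no sign, but the
    boundary term replacing them is nonnegative.\<close>
  also have "\<dots> \<le> 1 * (?W + surface_integral d (\<lambda>x. grad_sq d T v (x(d := s))))"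
    using s by (intro mult_right_mono add_nonneg_nonneg set_integral_nonneg_on surface_nonneg)
      (auto simp: grad_sq_def sum_nonneg)
  finally show ?thesis by simp
qed

theorem energy_estimate:
  assumes t: "t \<in> {0..T}"
  shows "(LINT x:Omega d|vol d. energy_density d T v (x(d := t)))
    \<le> exp (2 * T) * ((LINT x:Omega d|vol d. energy_density d T v (x(d := 0)))
        + (LINT z:Omega_T d T|vol (Suc d). (wave_op d T v z)\<^sup>2) + lateral_integral d T (grad_sq d T v))"
    (is "?E t \<le> exp (2 * T) * (?E 0 + ?A + ?B)")
proof -
  let ?W = "\<lambda>s. LINT x:Omega d|vol d. (wave_op d T v (x(d := s)))\<^sup>2"
  let ?S = "\<lambda>s. surface_integral d (\<lambda>x. grad_sq d T v (x(d := s)))"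
  have 0: "0 \<in> {0..T}" and TT: "T \<in> {0..T}" using T by auto
  have k: "bdd_cont (bdry_Omega_T d T) (grad_sq d T v)"
    by (rule bdd_cont_subset[OF bdd_cont_energy(2) bdry_subset_closed])
  have W: "set_integrable lborel {0..T} ?W"
    by (rule slice_integral_time_integrable[OF T bdd_cont_energy(3) TT])
  have S: "set_integrable lborel {0..T} ?S" by (rule surface_time_integrable[OF T k])
  have WS: "set_integrable lborel {0..T} (\<lambda>s. ?W s + ?S s)" by (rule set_integral_add(1)[OF W S])
  have nonneg: "0 \<le> ?W s + ?S s" for s
    by (intro add_nonneg_nonneg set_integral_nonneg_on surface_nonneg) (auto simp: grad_sq_def sum_nonneg)
  note e_int = slice_integrable[OF T bdd_cont_energy(1)]
  have "exp (- 2 * t) * ?E t - ?E 0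
      = (LINT x:Omega d|vol d. exp (- 2 * t) * energy_density d T v (x(d := t)) - energy_density d T v (x(d := 0)))"
    unfolding set_integral_diff(2)[OF set_integrable_mult_right[OF e_int[OF t]] e_int[OF 0]]
      set_integral_mult_right ..
  also have "\<dots> = (LINT x:Omega d|vol d. LINT s:{0..t}|lborel. energy_rate d T v (x(d := s)))"
    by (intro set_lebesgue_integral_cong[OF Omega_sets] allI impI energy_line_integral[symmetric] t)
  \<comment> \<open>The comparison is made along time lines, where the rate is an exact derivative;
    the order of integration is then exchanged, because the divergence must be integrated in space
    first.\<close>
  also have "\<dots> \<le> (LINT x:Omega d|vol d. LINT s:{0..t}|lborel. energy_rate_bound d T v (x(d := s)))"
  proof (intro set_integral_mono line_integral_integrable[OF T _ t] bdd_cont_energy_rate energy_rate_le)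
    fix x assume x: "x \<in> Omega d"
    show "set_integrable lborel {0..t} (\<lambda>s. energy_rate d T v (x(d := s)))"
      "set_integrable lborel {0..t} (\<lambda>s. energy_rate_bound d T v (x(d := s)))"
      unfolding set_integrable_def
      by (intro borel_integrable_compact compact_Icc time_line_continuous[OF _ x t] bdd_cont_energy_rate)+
  qed
  also have "\<dots> = (LINT s:{0..t}|lborel. LINT x:Omega d|vol d. energy_rate_bound d T v (x(d := s)))"
    by (rule space_time_Fubini(1)[OF T bdd_cont_energy_rate(2) t])
  also have "\<dots> \<le> (LINT s:{0..t}|lborel. ?W s + ?S s)"
  proof (rule set_integral_mono)
    show "set_integrable lborel {0..t} (\<lambda>s. LINT x:Omega d|vol d. energy_rate_bound d T v (x(d := s)))"
      by (rule slice_integral_time_integrable[OF T bdd_cont_energy_rate(2) t])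
    show "set_integrable lborel {0..t} (\<lambda>s. ?W s + ?S s)"
      using t by (intro set_integrable_subset[OF WS]) auto
  qed (use t slice_rate_bound in auto)
  \<comment> \<open>The integrand is nonnegative, so extending the time range to \<open>T\<close>
    makes the bound uniform in \<open>t\<close>.\<close>
  also have "\<dots> \<le> (LINT s:{0..T}|lborel. ?W s + ?S s)"
    using t nonneg by (intro set_integral_subset_mono[OF WS]) auto
  also have "\<dots> = ?A + ?B"
    unfolding lateral_integral_def space_time_Fubini(2)[OF T bdd_cont_energy(3) TT]
    by (rule set_integral_add(2)[OF W S])
  finally have main: "exp (- 2 * t) * ?E t \<le> ?E 0 + ?A + ?B" by simp
  have "?E t = exp (2 * t) * (exp (- 2 * t) * ?E t)" by (simp add: exp_minus)
  also have "\<dots> \<le> exp (2 * t) * (?E 0 + ?A + ?B)" using main by (intro mult_left_mono) auto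
  also have "\<dots> \<le> exp (2 * T) * (?E 0 + ?A + ?B)"
    using t by (intro mult_right_mono add_nonneg_nonneg set_integral_nonneg_on lateral_nonneg)
      (auto simp: energy_density_def grad_sq_def sum_nonneg)
  finally show ?thesis .
qed

end

section \<open>From the energy estimate to the loss\<close>

lemma D_single: "D I [i] u = pd I i u"
  by (simp add: D_def)

text \<open>The base points may differ off coordinate \<open>i\<close>: this compares a derivative
  of the initial datum, at a point of the cube, with one of a space-time function at time 0.
  Agreement on an open \<open>J\<close> is enough, since a derivative is local.\<close>

lemma pd_cong_within:
  assumes "\<And>r. r \<in> J \<Longrightarrow> u (z(i := r)) = w (z'(i := r))"
    and "open J" "z i \<in> J" "z i = z' i"
  shows "pd I i u z = pd I i w z'"
proof -
  have "\<forall>\<^sub>F r in nhds (z i). r \<in> J" using assms by (intro eventually_nhds_in_open)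
  then have "\<forall>\<^sub>F r in at (z i) within I i. u (z(i := r)) = w (z'(i := r))"
    unfolding eventually_at_filter by eventually_elim (use assms in auto)
  moreover have "u z = w z'" using assms(1)[of "z i"] assms(3,4) by (metis fun_upd_triv)
  ultimately have "((\<lambda>r. u (z(i := r))) has_vector_derivative c) (at (z i) within I i)
      \<longleftrightarrow> ((\<lambda>r. w (z'(i := r))) has_vector_derivative c) (at (z i) within I i)" for c
    using assms(4)
    by (intro has_vector_derivative_cong_ev)
      (auto simp: eventually_at_filter fun_upd_idem elim: eventually_mono)
  then show ?thesis unfolding pd_def vector_derivative_def assms(4) by simp
qed

lemma Omega_upd: "x \<in> Omega d \<Longrightarrow> i < d \<Longrightarrow> r \<in> {0<..<1} \<Longrightarrow> x(i := r) \<in> Omega d"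
  by (auto simp: Omega_def PiE_iff extensional_def)

lemma Omega_coord: "x \<in> Omega d \<Longrightarrow> i < d \<Longrightarrow> x i \<in> {0<..<1}"
  using PiE_mem[of x "{..<d}" "\<lambda>_. {0<..<1}" i] by (simp add: Omega_def)

lemma H1_bdry_sq_nonneg: "0 \<le> H1_bdry_sq d T w"
  unfolding H1_bdry_sq_def by (intro lateral_nonneg add_nonneg_nonneg sum_nonneg) auto

lemma loss_terms_nonneg:
  "0 \<le> (LINT z:Omega_T d T|vol (Suc d). (wave_op d T u z - f z)\<^sup>2)"
  "0 \<le> H1_sq d T w"
  "0 \<le> (LINT x:Omega d|vol d. (pd (side d T) d u (x(d := 0)) - \<psi> x)\<^sup>2)"
  unfolding H1_sq_def by (intro set_integral_nonneg_on; simp add: sum_nonneg)+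

definition H1_density :: "nat \<Rightarrow> real \<Rightarrow> ((nat \<Rightarrow> real) \<Rightarrow> real) \<Rightarrow> (nat \<Rightarrow> real) \<Rightarrow> real" where
  "H1_density d T w z =
     (w z)\<^sup>2 + (pd (side d T) d w z)\<^sup>2 + (\<Sum>i<d. (pd (side d T) i w z)\<^sup>2)"

lemma H1_bdry_sq_eq: "H1_bdry_sq d T w = lateral_integral d T (H1_density d T w)"
  unfolding H1_bdry_sq_def H1_density_def ..

context
  fixes d T f \<phi> \<psi> g \<kappa> u w
  assumes T: "T > 0"
    and setting: "wave_setting d T f \<phi> \<psi> g \<kappa> u"
    and w: "C2_norm d T w < \<infinity>"
begin

lemma u_norm: "C2_norm d T u < \<infinity>" using setting by (simp add: wave_setting_def)

lemmas u_reg = C_norm_finite[OF u_norm[unfolded C2_norm_def]]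
lemmas w_reg = C_norm_finite[OF w[unfolded C2_norm_def]]

lemma g_reg:
  "C_class (side d T) (Suc d) 1 (bdry_Omega_T d T) g"
  "l \<in> dwords (Suc d) 1 \<Longrightarrow> bdd_cont (bdry_Omega_T d T) (D (side d T) l g)"
proof -
  have "C_norm (side d T) (Suc d) 1 (bdry_Omega_T d T) g < \<infinity>"
    using setting by (auto simp: wave_setting_def intro: le_less_trans)
  from C_norm_finite[OF this]
  show "C_class (side d T) (Suc d) 1 (bdry_Omega_T d T) g"
    "l \<in> dwords (Suc d) 1 \<Longrightarrow> bdd_cont (bdry_Omega_T d T) (D (side d T) l g)" by blast+
qed

lemma diff_reg:
  "C_class (side d T) (Suc d) 2 (closed_Omega_T d T) (\<lambda>z. w z - u z)"
  "l \<in> dwords (Suc d) 2 \<Longrightarrow> bdd_cont (closed_Omega_T d T) (D (side d T) l (\<lambda>z. w z - u z))"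
proof -
  show "C_class (side d T) (Suc d) 2 (closed_Omega_T d T) (\<lambda>z. w z - u z)"
    by (rule C_class_diff_cyl[OF T w_reg(1) u_reg(1)])
  assume l: "l \<in> dwords (Suc d) 2"
  have "bdd_cont (closed_Omega_T d T) (\<lambda>z. D (side d T) l w z - D (side d T) l u z)"
    by (rule bdd_cont_diff[OF w_reg(2)[OF l] u_reg(2)[OF l]])
  then show "bdd_cont (closed_Omega_T d T) (D (side d T) l (\<lambda>z. w z - u z))"
    by (subst bdd_cont_cong[of _ _ "\<lambda>z. D (side d T) l w z - D (side d T) l u z"])
      (simp_all add: D_diff_cyl[OF T w_reg(1) u_reg(1) l])
qed

lemma wave_op_diff:
  assumes "z \<in> closed_Omega_T d T"
  shows "wave_op d T (\<lambda>z. w z - u z) z = wave_op d T w z - wave_op d T u z"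
proof -
  have "D (side d T) [i, i] (\<lambda>z. w z - u z) z = D (side d T) [i, i] w z - D (side d T) [i, i] u z"
    if "i < Suc d" for i
    using that by (intro D_diff_cyl[OF T w_reg(1) u_reg(1) _ assms]) (auto simp: dwords_def)
  then show ?thesis by (simp add: wave_op_def sum_subtractf)
qed

lemma residual_eq:
  "(LINT z:Omega_T d T|vol (Suc d). (wave_op d T w z - f z)\<^sup>2)
    = (LINT z:Omega_T d T|vol (Suc d). (wave_op d T (\<lambda>z. w z - u z) z)\<^sup>2)"
proof (rule set_lebesgue_integral_cong[OF Omega_T_sets], intro allI impI)
  fix z assume z: "z \<in> Omega_T d T"
  then have "wave_op d T u z = f z" using setting by (simp add: wave_setting_def strong_solution_def)
  then show "(wave_op d T w z - f z)\<^sup>2 = (wave_op d T (\<lambda>z. w z - u z) z)\<^sup>2"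
    using wave_op_diff z Omega_T_subset_closed by fastforce
qed

text \<open>On the open cube \<open>\<phi>\<close> and \<open>\<psi>\<close> are the traces of
  \<open>u\<close> and its time derivative, so the initial residuals of \<open>w\<close> are those
  of the difference. The spatial derivatives of \<open>\<phi>\<close> agree as well, because a point
  of the cube can be moved a little along each axis without leaving it.\<close>

lemma initial_eq:
  "(LINT x:Omega d|vol d. energy_density d T (\<lambda>z. w z - u z) (x(d := 0)))
    = H1_sq d T (\<lambda>x. w (x(d := 0)) - \<phi> x)
      + (LINT x:Omega d|vol d. (pd (side d T) d w (x(d := 0)) - \<psi> x)\<^sup>2)"
proof -
  let ?v = "\<lambda>z. w z - u z"
  have 0: "0 \<in> {0..T}" using T by simp
  have \<phi>: "u (x(d := 0)) = \<phi> x" and \<psi>: "pd (side d T) d u (x(d := 0)) = \<psi> x" if "x \<in> Omega d" for x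
    using setting that by (simp_all add: wave_setting_def strong_solution_def)
  have pd: "pd (side d T) i (\<lambda>x. w (x(d := 0)) - \<phi> x) x = D (side d T) [i] ?v (x(d := 0))"
    if x: "x \<in> Omega d" and i: "i < d" for x i
    unfolding D_single
  proof (rule pd_cong_within[where J="{0<..<1}"])
    show "w ((x(i := r))(d := 0)) - \<phi> (x(i := r)) = w (x(d := 0, i := r)) - u (x(d := 0, i := r))"
      if "r \<in> {0<..<1}" for r
      using \<phi>[OF Omega_upd[OF x i that]] i by (simp add: fun_upd_twist)
  qed (use Omega_coord[OF x i] i in auto)
  have d: "pd (side d T) d w (x(d := 0)) - \<psi> x = D (side d T) [d] ?v (x(d := 0))" if x: "x \<in> Omega d" for x
    using D_diff_cyl[OF T w_reg(1) u_reg(1) _ Omega_upd_closed_cyl[OF x 0], of "[d]"]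
    by (simp add: D_single \<psi>[OF x] dwords_def)
  let ?h1 = "\<lambda>z. (?v z)\<^sup>2 + (\<Sum>i<d. (D (side d T) [i] ?v z)\<^sup>2)"
  let ?h2 = "\<lambda>z. (D (side d T) [d] ?v z)\<^sup>2"
  note bd = bdd_cont_D[OF T diff_reg]
  have h: "bdd_cont (closed_Omega_T d T) ?h1" "bdd_cont (closed_Omega_T d T) ?h2"
    by (intro bdd_cont_intros bd; simp)+
  have H: "H1_sq d T (\<lambda>x. w (x(d := 0)) - \<phi> x) = (LINT x:Omega d|vol d. ?h1 (x(d := 0)))"
    unfolding H1_sq_def by (rule set_lebesgue_integral_cong[OF Omega_sets]) (simp add: \<phi> pd)
  have P: "(LINT x:Omega d|vol d. (pd (side d T) d w (x(d := 0)) - \<psi> x)\<^sup>2)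
      = (LINT x:Omega d|vol d. ?h2 (x(d := 0)))"
    by (rule set_lebesgue_integral_cong[OF Omega_sets]) (simp add: d)
  have "(LINT x:Omega d|vol d. energy_density d T ?v (x(d := 0)))
      = (LINT x:Omega d|vol d. ?h1 (x(d := 0)) + ?h2 (x(d := 0)))"
    by (simp add: energy_density_def algebra_simps)
  also have "\<dots> = (LINT x:Omega d|vol d. ?h1 (x(d := 0))) + (LINT x:Omega d|vol d. ?h2 (x(d := 0)))"
    by (rule set_integral_add(2)[OF slice_integrable[OF T h(1) 0] slice_integrable[OF T h(2) 0]])
  finally show ?thesis unfolding H P .
qed

text \<open>\<open>C_class\<close> on the lateral boundary includes differentiability of
  \<open>g\<close> in every coordinate direction, hence also in the normal one, where the derivative
  is one-sided; linearity therefore holds for the full gradient.\<close>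

lemma bdry_diff_g:
  assumes a: "C_class (side d T) (Suc d) 2 (closed_Omega_T d T) a"
    and z: "z \<in> bdry_Omega_T d T" and i: "i < Suc d"
  shows "pd (side d T) i (\<lambda>z. a z - g z) z = D (side d T) [i] a z - D (side d T) [i] g z"
  unfolding D_single
proof (rule pd_diff)
  have zc: "z \<in> closed_Omega_T d T" using z bdry_subset_closed by blast
  have l: "[i] \<in> dwords (Suc d) 2" "[i] \<in> dwords (Suc d) 1" using i by (auto simp: dwords_def)
  show "(\<lambda>r. a (z(i := r))) differentiable at (z i) within side d T i"
    using a l zc by (force simp: C_class_def D_Nil)
  show "(\<lambda>r. g (z(i := r))) differentiable at (z i) within side d T i"
    using g_reg(1) l z by (force simp: C_class_def D_Nil)
  show "at (z i) within side d T i \<noteq> bot"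
    by (rule side_nontrivial[OF T closed_cyl_coord[OF zc i]])
qed

lemma bdd_cont_bdry_density:
  assumes a: "C_class (side d T) (Suc d) 2 (closed_Omega_T d T) a"
    and b: "\<And>l. l \<in> dwords (Suc d) 2 \<Longrightarrow> bdd_cont (closed_Omega_T d T) (D (side d T) l a)"
  shows "bdd_cont (bdry_Omega_T d T) (H1_density d T (\<lambda>z. a z - g z))"
proof -
  have 1: "bdd_cont (bdry_Omega_T d T) (D (side d T) l a)" if "l \<in> dwords (Suc d) 1" for l
    using that by (intro bdd_cont_subset[OF b bdry_subset_closed]) (auto simp: dwords_def)
  have p: "bdd_cont (bdry_Omega_T d T) (pd (side d T) i (\<lambda>z. a z - g z))" if i: "i < Suc d" for i
  proof -
    have l: "[i] \<in> dwords (Suc d) 1" using i by (auto simp: dwords_def)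
    show ?thesis
      using bdd_cont_diff[OF 1[OF l] g_reg(2)[OF l]]
      by (subst bdd_cont_cong[OF bdry_diff_g[OF a _ i]])
  qed
  have "[] \<in> dwords (Suc d) 1" by (simp add: dwords_def)
  from bdd_cont_diff[OF 1[OF this] g_reg(2)[OF this]]
  have ag: "bdd_cont (bdry_Omega_T d T) (\<lambda>z. a z - g z)" unfolding D_Nil .
  show ?thesis unfolding H1_density_def
    by (intro bdd_cont_add bdd_cont_power2 bdd_cont_sum ag p) auto
qed

text \<open>
  The boundary datum is unrelated to \<open>u\<close> off the lateral boundary, so the normal derivatives of
  \<open>u\<close> and \<open>g\<close> are compared only through the boundary term of the loss of \<open>u\<close>, which vanishes.
\<close>

lemma lateral_bound:
  "lateral_integral d T (grad_sq d T (\<lambda>z. w z - u z))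
    \<le> 2 * H1_bdry_sq d T (\<lambda>z. w z - g z) + 2 * H1_bdry_sq d T (\<lambda>z. u z - g z)"
proof -
  let ?hw = "H1_density d T (\<lambda>z. w z - g z)" and ?hu = "H1_density d T (\<lambda>z. u z - g z)"
  have hw: "bdd_cont (bdry_Omega_T d T) ?hw" by (rule bdd_cont_bdry_density[OF w_reg])
  have hu: "bdd_cont (bdry_Omega_T d T) ?hu" by (rule bdd_cont_bdry_density[OF u_reg])
  have hw2: "bdd_cont (bdry_Omega_T d T) (\<lambda>z. 2 * ?hw z)" and hu2: "bdd_cont (bdry_Omega_T d T) (\<lambda>z. 2 * ?hu z)"
    by (intro bdd_cont_mult bdd_cont_const hw hu)+
  have sq: "(D (side d T) [i] (\<lambda>z. w z - u z) z)\<^sup>2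
      \<le> 2 * (pd (side d T) i (\<lambda>z. w z - g z) z)\<^sup>2 + 2 * (pd (side d T) i (\<lambda>z. u z - g z) z)\<^sup>2"
    if z: "z \<in> bdry_Omega_T d T" and i: "i < Suc d" for z i
  proof -
    have "D (side d T) [i] (\<lambda>z. w z - u z) z = D (side d T) [i] w z - D (side d T) [i] u z"
      using z bdry_subset_closed i by (intro D_diff_cyl[OF T w_reg(1) u_reg(1)]) (auto simp: dwords_def)
    also have "\<dots> = pd (side d T) i (\<lambda>z. w z - g z) z - pd (side d T) i (\<lambda>z. u z - g z) z"
      by (simp add: bdry_diff_g[OF w_reg(1) z i] bdry_diff_g[OF u_reg(1) z i])
    finally have eq: "D (side d T) [i] (\<lambda>z. w z - u z) z
      = pd (side d T) i (\<lambda>z. w z - g z) z - pd (side d T) i (\<lambda>z. u z - g z) z" .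
    show ?thesis unfolding eq
      \<comment> \<open>(a - b)^2 + (a + b)^2 = 2 a^2 + 2 b^2.\<close>
      using zero_le_power2[of "pd (side d T) i (\<lambda>z. w z - g z) z + pd (side d T) i (\<lambda>z. u z - g z) z"]
      by (simp add: power2_sum power2_diff)
  qed
  have "lateral_integral d T (grad_sq d T (\<lambda>z. w z - u z)) \<le> lateral_integral d T (\<lambda>z. 2 * ?hw z + 2 * ?hu z)"
  proof (rule lateral_mono[OF T])
    show "bdd_cont (bdry_Omega_T d T) (grad_sq d T (\<lambda>z. w z - u z))"
      by (rule bdd_cont_subset[OF bdd_cont_energy(2)[OF T diff_reg] bdry_subset_closed])
    show "bdd_cont (bdry_Omega_T d T) (\<lambda>z. 2 * ?hw z + 2 * ?hu z)" by (rule bdd_cont_add[OF hw2 hu2])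
    fix z assume z: "z \<in> bdry_Omega_T d T"
    have "(\<Sum>i<d. (D (side d T) [i] (\<lambda>z. w z - u z) z)\<^sup>2) \<le>
      (\<Sum>i<d. 2 * (pd (side d T) i (\<lambda>z. w z - g z) z)\<^sup>2 + 2 * (pd (side d T) i (\<lambda>z. u z - g z) z)\<^sup>2)"
      by (intro sum_mono sq z) auto
    then show "grad_sq d T (\<lambda>z. w z - u z) z \<le> 2 * ?hw z + 2 * ?hu z"
      using sq[OF z lessI] zero_le_power2[of "w z - g z"] zero_le_power2[of "u z - g z"]
      unfolding grad_sq_def H1_density_def sum.distrib sum_distrib_left[symmetric] by argo
  qed
  also have "\<dots> = 2 * H1_bdry_sq d T (\<lambda>z. w z - g z) + 2 * H1_bdry_sq d T (\<lambda>z. u z - g z)"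
    unfolding lateral_add[OF T hw2 hu2] lateral_cmult H1_bdry_sq_eq ..
  finally show ?thesis .
qed

text \<open>Initial energy and interior residual are terms of the loss of \<open>w\<close> as they
  stand; only the lateral term carries the factor 2. Doubling the nonnegative remaining terms too
  gives twice the whole loss.\<close>

theorem energy_le_loss:
  assumes t: "t \<in> {0..T}"
  shows "(LINT x:Omega d|vol d. energy_density d T (\<lambda>z. w z - u z) (x(d := t)))
    \<le> 2 * exp (2 * T) * loss d T f \<phi> \<psi> g w"
proof -
  have "loss d T f \<phi> \<psi> g u = 0" using setting by (simp add: wave_setting_def)
  \<comment> \<open>The loss is a sum of nonnegative terms, so zero loss of \<open>u\<close> leaves
    nothing for the boundary term.\<close>
  then have u0: "H1_bdry_sq d T (\<lambda>z. u z - g z) \<le> 0"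
    using loss_terms_nonneg(1)[of d T u f] loss_terms_nonneg(2)[of d T "\<lambda>x. u (x(d := 0)) - \<phi> x"]
      loss_terms_nonneg(3)[of d T u \<psi>] unfolding loss_def by linarith
  let ?E = "LINT x:Omega d|vol d. energy_density d T (\<lambda>z. w z - u z) (x(d := 0))"
  let ?A = "LINT z:Omega_T d T|vol (Suc d). (wave_op d T (\<lambda>z. w z - u z) z)\<^sup>2"
  have E: "0 \<le> ?E" "0 \<le> ?A"
    by (intro set_integral_nonneg_on; simp add: energy_density_def sum_nonneg)+
  have L: "loss d T f \<phi> \<psi> g w = ?A + ?E + H1_bdry_sq d T (\<lambda>z. w z - g z)"
    unfolding loss_def residual_eq initial_eq by simp
  have "?E + ?A + lateral_integral d T (grad_sq d T (\<lambda>z. w z - u z)) \<le> 2 * loss d T f \<phi> \<psi> g w"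
    using lateral_bound u0 E unfolding L by argo
  then have "exp (2 * T) * (?E + ?A + lateral_integral d T (grad_sq d T (\<lambda>z. w z - u z)))
      \<le> exp (2 * T) * (2 * loss d T f \<phi> \<psi> g w)" by (intro mult_left_mono) auto
  from order_trans[OF energy_estimate[OF T diff_reg t] this] show ?thesis
    by (simp only: mult.assoc mult.left_commute)
qed

lemma energy_split:
  assumes t: "t \<in> {0..T}"
  shows "(LINT x:Omega d|vol d. (pd (side d T) d (\<lambda>z. w z - u z) (x(d := t)))\<^sup>2
            + (\<Sum>i<d. (pd (side d T) i (\<lambda>z. w z - u z) (x(d := t)))\<^sup>2))
         + (LINT x:Omega d|vol d. ((w (x(d := t)) - u (x(d := t))))\<^sup>2)
       = (LINT x:Omega d|vol d. energy_density d T (\<lambda>z. w z - u z) (x(d := t)))"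
proof -
  have h: "bdd_cont (closed_Omega_T d T) (grad_sq d T (\<lambda>z. w z - u z))"
    "bdd_cont (closed_Omega_T d T) (\<lambda>z. (w z - u z)\<^sup>2)"
    by (rule bdd_cont_energy(2)[OF T diff_reg], assumption)
      (rule bdd_cont_power2[OF bdd_cont_D(1)[OF T diff_reg]])
  show ?thesis
    using set_integral_add(2)[OF slice_integrable[OF T h(1) t] slice_integrable[OF T h(2) t]]
    by (simp add: grad_sq_def energy_density_def D_single algebra_simps)
qed

end

lemma loss_nonneg: "0 \<le> loss d T f \<phi> \<psi> g u"
  unfolding loss_def by (intro add_nonneg_nonneg loss_terms_nonneg H1_bdry_sq_nonneg)

theorem mainTheorem2:
  shows "\<exists>C :: real \<Rightarrow> real.
    \<forall>(T :: real) (d :: nat) (f :: (nat \<Rightarrow> real) \<Rightarrow> real) (\<phi> :: (nat \<Rightarrow> real) \<Rightarrow> real)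
      (\<psi> :: (nat \<Rightarrow> real) \<Rightarrow> real) (g :: (nat \<Rightarrow> real) \<Rightarrow> real) (\<kappa> :: real)
      (ustar :: (nat \<Rightarrow> real) \<Rightarrow> real) (depth :: nat) (width :: nat)
      (N :: nat) (M :: nat) (K :: nat)
      (X :: nat \<Rightarrow> nat \<Rightarrow> real) (Y :: nat \<Rightarrow> nat \<Rightarrow> real) (\<tau> :: nat \<Rightarrow> real)
      (uhat :: (nat \<Rightarrow> real) \<Rightarrow> real).
      T > 0 \<longrightarrow> d \<ge> 1 \<longrightarrow> wave_setting d T f \<phi> \<psi> g \<kappa> ustar \<longrightarrow>
      N \<ge> 1 \<longrightarrow> M \<ge> 1 \<longrightarrow> K \<ge> 1 \<longrightarrow>
      (\<forall>n<N. X n \<in> Omega d) \<longrightarrow> (\<forall>m<M. Y m \<in> bdry_Omega d) \<longrightarrow> (\<forall>k<K. \<tau> k \<in> {0..T}) \<longrightarrow>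
      is_arg_min (empirical_loss d T f \<phi> \<psi> g N M K X Y \<tau>)
        (\<lambda>u. u \<in> NN_class (Suc d) depth width (C2_norm d T) (B_const d T \<kappa> ustar) {ReLU3})
        uhat \<longrightarrow>
      loss d T f \<phi> \<psi> g uhat - loss d T f \<phi> \<psi> g ustar < 1 \<longrightarrow>
      (let v = (\<lambda>z. uhat z - ustar z);
           \<gamma> = C T * (1 + 3 * sqrt (real d) * B_const d T \<kappa> ustar * area_bdry_Omega_T d T)
       in \<forall>t\<in>{0..T}.
         (LINT x:Omega d|vol d. (pd (side d T) d v (x(d := t)))\<^sup>2
            + (\<Sum>i<d. (pd (side d T) i v (x(d := t)))\<^sup>2))
         + (LINT x:Omega d|vol d. (v (x(d := t)))\<^sup>2)
         \<le> \<gamma> * sqrt (loss d T f \<phi> \<psi> g uhat - loss d T f \<phi> \<psi> g ustar))"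
proof (intro exI[of _ "\<lambda>T. 2 * exp (2 * T)"] allI impI)
  fix T :: real and d :: nat and f \<phi> \<psi> g :: "(nat \<Rightarrow> real) \<Rightarrow> real" and \<kappa> :: real
    and ustar :: "(nat \<Rightarrow> real) \<Rightarrow> real" and depth width N M K :: nat
    and X Y :: "nat \<Rightarrow> nat \<Rightarrow> real" and \<tau> :: "nat \<Rightarrow> real" and uhat :: "(nat \<Rightarrow> real) \<Rightarrow> real"
  assume T: "T > 0" and setting: "wave_setting d T f \<phi> \<psi> g \<kappa> ustar"
    and minimizer: "is_arg_min (empirical_loss d T f \<phi> \<psi> g N M K X Y \<tau>)
        (\<lambda>u. u \<in> NN_class (Suc d) depth width (C2_norm d T) (B_const d T \<kappa> ustar) {ReLU3}) uhat"
    and small: "loss d T f \<phi> \<psi> g uhat - loss d T f \<phi> \<psi> g ustar < 1"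
  let ?L = "loss d T f \<phi> \<psi> g uhat"
  let ?C = "2 * exp (2 * T) * (1 + 3 * sqrt (real d) * B_const d T \<kappa> ustar * area_bdry_Omega_T d T)"
  \<comment> \<open>Membership in the network class bounds the norm by a real number; since the norm
    is infinite outside the space, this also supplies the \<open>C\<^sup>2\<close> regularity of
    \<open>uhat\<close>.\<close>
  have "C2_norm d T uhat \<le> ennreal (B_const d T \<kappa> ustar)"
    using minimizer by (auto simp: is_arg_min_def NN_class_def)
  then have uhat: "C2_norm d T uhat < \<infinity>" by (auto intro: le_less_trans)
  have L0: "loss d T f \<phi> \<psi> g ustar = 0" using setting by (simp add: wave_setting_def)
  have L: "0 \<le> ?L" "?L < 1" using loss_nonneg small L0 by auto
  \<comment> \<open>The even power makes the maximum defining \<open>B_const\<close> nonnegative, so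
    the bracket in \<gamma> is at least 1.\<close>
  have "0 \<le> \<kappa> ^ 4" by simp
  also have "\<dots> \<le> B_const d T \<kappa> ustar" by (simp add: B_const_def)
  finally have "0 \<le> B_const d T \<kappa> ustar" .
  moreover have "0 \<le> area_bdry_Omega_T d T" by (rule lateral_nonneg) simp
  ultimately have "1 \<le> 1 + 3 * sqrt (real d) * B_const d T \<kappa> ustar * area_bdry_Omega_T d T" by simp
  then have C: "2 * exp (2 * T) \<le> ?C" by simp
  have "?L * ?L \<le> 1 * ?L" using L by (intro mult_right_mono) auto
  then have sqrt_L: "?L \<le> sqrt ?L" by (intro real_le_rsqrt) (simp add: power2_eq_square)
  have "0 \<le> ?C" by (rule order_trans[OF _ C]) simp
  then have main: "2 * exp (2 * T) * ?L \<le> ?C * sqrt ?L" by (rule mult_mono[OF C sqrt_L _ L(1)])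
  show "let v = \<lambda>z. uhat z - ustar z; \<gamma> = ?C
    in \<forall>t\<in>{0..T}.
      (LINT x:Omega d|vol d. (pd (side d T) d v (x(d := t)))\<^sup>2
         + (\<Sum>i<d. (pd (side d T) i v (x(d := t)))\<^sup>2))
      + (LINT x:Omega d|vol d. (v (x(d := t)))\<^sup>2)
      \<le> \<gamma> * sqrt (?L - loss d T f \<phi> \<psi> g ustar)"
    unfolding Let_def L0 diff_zero
  proof
    fix t assume t: "t \<in> {0..T}"
    show "(LINT x:Omega d|vol d. (pd (side d T) d (\<lambda>z. uhat z - ustar z) (x(d := t)))\<^sup>2
         + (\<Sum>i<d. (pd (side d T) i (\<lambda>z. uhat z - ustar z) (x(d := t)))\<^sup>2))
      + (LINT x:Omega d|vol d. (uhat (x(d := t)) - ustar (x(d := t)))\<^sup>2) \<le> ?C * sqrt ?L"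
      unfolding energy_split[OF T setting uhat t]
      by (rule order_trans[OF energy_le_loss[OF T setting uhat t] main])
  qed
qed

end
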